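(* Consider the decomposed system and the DD-LSPG reduced-order model described in the context, in either the interior/boundary-bases case (with trial subspace $\mathcal S=\mathcal S_{\text{I/B}}$) or the full-subdomain-bases case (with trial subspace $\mathcal S=\mathcal S_{\text F}$). Assume: (A1) strong constraints are employed, i.e. $\boldsymbol A_i=\bar{\boldsymbol A}_i$ for $i=1,\dots,n_\Omega$; (A2) there exists $\kappa_\ell>0$ such that for all $\boldsymbol w,\boldsymbol y\in\mathbb R^n$ $$\Big(\sum_{i=1}^{n_\Omega}\|\boldsymbol r_i(\boldsymbol P_i^\Omega\boldsymbol w,\boldsymbol P_i^\Gamma\boldsymbol w)-\boldsymbol r_i(\boldsymbol P_i^\Omega\boldsymbol y,\boldsymbol P_i^\Gamma\boldsymbol y)\|_2^2\Big)^{1/2}\ \ge\ \kappa_\ell\,\|\boldsymbol w-\boldsymbol y\|_2;$$ (A3) there exists $P>0$ such that for all $\boldsymbol w\in\mathcal S$ $$\Big(\sum_{i=1}^{n_\Omega}\|\boldsymbol B_i\boldsymbol r_i(\boldsymbol P_i^\Omega\boldsymbol w,\boldsymbol P_i^\Gamma\boldsymbol w)\|_2^2\Big)^{1/2}\ \ge\ P\,\Big(\sum_{i=1}^{n_\Omega}\|\boldsymbol r_i(\boldsymbol P_i^\Omega\boldsymbol w,\boldsymbol P_i^\Gamma\boldsymbol w)\|_2^2\Big)^{1/2};$$ (A4) there exists $\kappa_u>0$ such that for all $\boldsymbol w,\boldsymbol y\in\mathbb R^n$ $$\Big(\sum_{i=1}^{n_\Omega}\|\boldsymbol B_i\boldsymbol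 r_i(\boldsymbol P_i^\Omega\boldsymbol w,\boldsymbol P_i^\Gamma\boldsymbol w)-\boldsymbol B_i\boldsymbol r_i(\boldsymbol P_i^\Omega\boldsymbol y,\boldsymbol P_i^\Gamma\boldsymbol y)\|_2^2\Big)^{1/2}\ \le\ \kappa_u\,\|\boldsymbol w-\boldsymbol y\|_2.$$ Let $\boldsymbol x\in\mathbb R^n$ be the full-order solution, i.e. $\boldsymbol r(\boldsymbol x)=\boldsymbol 0$, with $\boldsymbol x_i^\Omega=\boldsymbol P_i^\Omega\boldsymbol x$, and let $\tilde{\boldsymbol x}\in\mathbb R^n$ be the global DD-LSPG solution, with $\tilde{\boldsymbol x}_i^\Omega=\boldsymbol P_i^\Omega\tilde{\boldsymbol x}$. Then, for both types of bases, $$\max\Big(\max_{i\in\{1,\dots,n_\Omega\}}\|\boldsymbol x_i^\Omega-\tilde{\boldsymbol x}_i^\Omega\|_2,\ \max_{j\in\{1,\dots,n_p\}}\|\boldsymbol P^{j}\boldsymbol x-\boldsymbol P^{j}\tilde{\boldsymbol x}\|_2\Big)\ \le\ \frac{\kappa_u\sqrt{n_\Omega+n_p}}{P\,\kappa_\ell}\ \min_{\boldsymbol w\in\mathcal S}\ \max\Big(\max_{i\in\{1,\dots,n_\Omega\}}\|\boldsymbol x_i^\Omega-\boldsymbol P_i^\Omega\boldsymbol w\|_2,\ \max_{j\in\{1,\dots,n_p\}}\|\boldsymbol P^{j}\boldsymbol x-\boldsymbol P^{j}\boldsymbol w\|_2\Big).$$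
   Context: Full-order model and algebraic decomposition. $\boldsymbol r:\mathbb R^n\to\mathbb R^n$ is a (nonlinear) residual with $$\boldsymbol r(\boldsymbol w)=\sum_{i=1}^{n_\Omega}[\boldsymbol P_i^{r}]^T\boldsymbol r_i(\boldsymbol P_i^\Omega\boldsymbol w,\boldsymbol P_i^\Gamma\boldsymbol w)\quad\text{for all }\boldsymbol w\in\mathbb R^n,$$ where $\boldsymbol r_i:\mathbb R^{n_i^\Omega}\times\mathbb R^{n_i^\Gamma}\to\mathbb R^{n_i^r}$ are subdomain residuals and $\boldsymbol P_i^r\in\{0,1\}^{n_i^r\times n}$, $\boldsymbol P_i^\Omega\in\{0,1\}^{n_i^\Omega\times n}$, $\boldsymbol P_i^\Gamma\in\{0,1\}^{n_i^\Gamma\times n}$ are sampling matrices (each consists of distinct selected rows of the $n\times n$ identity) extracting residual entries, interior states and interface states of subdomain $i$. They satisfy $\boldsymbol P_i^r[\boldsymbol P_j^r]^T=\boldsymbol 0$ and $\boldsymbol P_i^\Omega[\boldsymbol P_j^\Omega]^T=\boldsymbol 0$ for $i\ne j$, and $\sum_i n_i^r=n$. Put $n_i=n_i^\Omega+n_i^\Gamma$. Ports. There are $n_p$ ports. Port $j$ is a group of $n_j^p$ global degrees of freedom shared by a fixed set of subdomains $\mathcal P(j)\subseteq\{1,\dots,n_\Omega\}$. For $i\in\mathcal P(j)$, $\boldsymbol P_i^j\in\{0,1\}^{n_j^p\times n_i^\Gamma}$ consists of selected rows of the $n_i^\Gamma\times n_i^\Gamma$ identity and extracts the degrees of freedom of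 port $j$ from the interface state of subdomain $i$. $\boldsymbol P^j\in\{0,1\}^{n_j^p\times n}$ consists of selected rows of the $n\times n$ identity and extracts from the global state the degrees of freedom of port $j$; thus $\boldsymbol P_i^j\boldsymbol P_i^\Gamma=\boldsymbol P^j$ for every $i\in\mathcal P(j)$. For each subdomain $i$, with $\mathcal Q(i)=\{j: i\in\mathcal P(j)\}$, the ports are non-overlapping, $\boldsymbol P_i^j[\boldsymbol P_i^\ell]^T=\boldsymbol 0$ for $j\neq\ell$ in $\mathcal Q(i)$, and $\sum_{j\in\mathcal Q(i)}n_j^p=n_i^\Gamma$. The global degrees of freedom $\{1,\dots,n\}$ are partitioned into segments: one for the interior degrees of freedom of each subdomain and one for each port. Strong compatibility constraints. $\bar{\boldsymbol A}_i\in\{-1,0,1\}^{n_{\bar A}\times n_i^\Gamma}$, $i=1,\dots,n_\Omega$, with $n_{\bar A}=\sum_j(|\mathcal P(j)|-1)n_j^p$, are matrices assembled so that $\sum_i\bar{\boldsymbol A}_i\boldsymbol y_i=\boldsymbol 0$ (with $\boldsymbol y_i\in\mathbb R^{n_i^\Gamma}$) holds if and only if $\boldsymbol P_i^j\boldsymbol y_i=\boldsymbol P_\ell^j\boldsymbol y_\ell$ for all $i,\ell\in\mathcal P(j)$ and all $j$. Bases. Interior/boundary-bases case: full-column-rank matrices $\boldsymbol\Phi_i^\Omega\in\mathbb R^{n_i^\Omega\times p_i^\Omega}$ and $\boldsymbol\Phi_i^\Gamma\in\mathbb R^{n_i^\Gamma\times p_i^\Gamma}$ are given. Full-subdomain-bases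 case: a full-column-rank matrix $\boldsymbol\Phi_i\in\mathbb R^{n_i\times p_i}$ is given for each $i$, and $\boldsymbol\Phi_i^\Omega\in\mathbb R^{n_i^\Omega\times p_i}$, $\boldsymbol\Phi_i^\Gamma\in\mathbb R^{n_i^\Gamma\times p_i}$ are its blocks of rows corresponding to interior and interface degrees of freedom ($p_i^\Omega=p_i^\Gamma=p_i$; these blocks need not have full column rank individually). DD-LSPG reduced-order model. Given matrices $\boldsymbol B_i\in\mathbb R^{n_i^B\times n_i^r}$ with $n_i^B\le n_i^r$ and constraint matrices $\boldsymbol A_i\in\mathbb R^{n_A\times n_i^\Gamma}$: - interior/boundary bases: $(\hat{\boldsymbol x}_i^\Omega,\hat{\boldsymbol x}_i^\Gamma)_{i}$ is a solution of: minimize $\frac12\sum_i\|\boldsymbol B_i\boldsymbol r_i(\boldsymbol\Phi_i^\Omega\hat{\boldsymbol w}_i^\Omega,\boldsymbol\Phi_i^\Gamma\hat{\boldsymbol w}_i^\Gamma)\|_2^2$ over $(\hat{\boldsymbol w}_i^\Omega,\hat{\boldsymbol w}_i^\Gamma)_i$ subject to $\sum_i\boldsymbol A_i\boldsymbol\Phi_i^\Gamma\hat{\boldsymbol w}_i^\Gamma=\boldsymbol 0$; one sets $\tilde{\boldsymbol x}_i^\Omega=\boldsymbol\Phi_i^\Omega\hat{\boldsymbol x}_i^\Omega$, $\tilde{\boldsymbol x}_i^\Gamma=\boldsymbol\Phi_i^\Gamma\hat{\boldsymbol x}_i^\Gamma$; - full-subdomain bases: $(\hat{\boldsymbol x}_i)_i$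 is a solution of: minimize $\frac12\sum_i\|\boldsymbol B_i\boldsymbol r_i(\boldsymbol\Phi_i^\Omega\hat{\boldsymbol w}_i,\boldsymbol\Phi_i^\Gamma\hat{\boldsymbol w}_i)\|_2^2$ over $(\hat{\boldsymbol w}_i)_i$ subject to $\sum_i\boldsymbol A_i\boldsymbol\Phi_i^\Gamma\hat{\boldsymbol w}_i=\boldsymbol 0$; one sets $\tilde{\boldsymbol x}_i^\Omega=\boldsymbol\Phi_i^\Omega\hat{\boldsymbol x}_i$, $\tilde{\boldsymbol x}_i^\Gamma=\boldsymbol\Phi_i^\Gamma\hat{\boldsymbol x}_i$. When $\boldsymbol A_i=\bar{\boldsymbol A}_i$ for all $i$, the subdomain solutions agree on ports, and the global DD-LSPG solution is the vector $\tilde{\boldsymbol x}\in\mathbb R^n$ with $\boldsymbol P_i^\Omega\tilde{\boldsymbol x}=\tilde{\boldsymbol x}_i^\Omega$ and $\boldsymbol P_i^\Gamma\tilde{\boldsymbol x}=\tilde{\boldsymbol x}_i^\Gamma$ for all $i$. Trial subspaces. Let $\bar{\boldsymbol A}=[\bar{\boldsymbol A}_1\boldsymbol\Phi_1^\Gamma\ \cdots\ \bar{\boldsymbol A}_{n_\Omega}\boldsymbol\Phi_{n_\Omega}^\Gamma]$, $p^{\text{null}}=\sum_ip_i^\Gamma-\operatorname{rank}(\bar{\boldsymbol A})$, and let $\bar{\boldsymbol N}\in\mathbb R^{(\sum_ip_i^\Gamma)\times p^{\text{null}}}$ be a matrix whose columns form a basis of the null space of $\bar{\boldsymbol A}$,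 with $i$th row block $\bar{\boldsymbol N}_i\in\mathbb R^{p_i^\Gamma\times p^{\text{null}}}$. In the interior/boundary-bases case, $$\mathcal S_{\text{I/B}}=\{\boldsymbol w\in\mathbb R^n:\ \exists\,\hat{\boldsymbol w}_i^\Omega\in\mathbb R^{p_i^\Omega}\ (i=1,\dots,n_\Omega),\ \hat{\boldsymbol w}^{\text{null}}\in\mathbb R^{p^{\text{null}}}\text{ with }\boldsymbol P_i^\Omega\boldsymbol w=\boldsymbol\Phi_i^\Omega\hat{\boldsymbol w}_i^\Omega,\ \boldsymbol P_i^\Gamma\boldsymbol w=\boldsymbol\Phi_i^\Gamma\bar{\boldsymbol N}_i\hat{\boldsymbol w}^{\text{null}}\ \forall i\},$$ and in the full-subdomain-bases case, $$\mathcal S_{\text F}=\{\boldsymbol w\in\mathbb R^n:\ \exists\,\hat{\boldsymbol w}^{\text{null}}\in\mathbb R^{p^{\text{null}}}\text{ with }\boldsymbol P_i^\Omega\boldsymbol w=\boldsymbol\Phi_i^\Omega\bar{\boldsymbol N}_i\hat{\boldsymbol w}^{\text{null}},\ \boldsymbol P_i^\Gamma\boldsymbol w=\boldsymbol\Phi_i^\Gamma\bar{\boldsymbol N}_i\hat{\boldsymbol w}^{\text{null}}\ \forall i\}.$$ *)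

theory Defs
  imports
    "HOL-Analysis.L2_Norm"
    "HOL-Library.Disjoint_Sets"
    "Jordan_Normal_Form.DL_Rank"
    "Jordan_Normal_Form.Matrix_Kernel"
begin

text \<open>
  Vectors and matrices carry run-time dimensions, because every subdomain and every port has its own
  sizes. Subdomains, ports, matrix rows and columns are all numbered from 0.
\<close>

definition norm2 :: "real vec \<Rightarrow> real" where
  "norm2 v = L2_set (vec_index v) {..<dim_vec v}"

definition sampling_matrix :: "nat \<Rightarrow> nat \<Rightarrow> real mat \<Rightarrow> bool" where
  "sampling_matrix m n P \<longleftrightarrow>
     P \<in> carrier_mat m n \<and> distinct (rows P) \<and> set (rows P) \<subseteq> set (rows (1\<^sub>m n))"

definition full_column_rank :: "real mat \<Rightarrow> bool" where
  "full_column_rank A \<longleftrightarrow> vec_space.rank (dim_row A) A = dim_col A"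

section \<open>Decomposed system\<close>

record dd_system =
  ndof :: nat
  nsub :: nat
  nint :: "nat \<Rightarrow> nat"
  nifc :: "nat \<Rightarrow> nat"
  nres :: "nat \<Rightarrow> nat"
  Pint :: "nat \<Rightarrow> real mat"
  Pifc :: "nat \<Rightarrow> real mat"
  Pres :: "nat \<Rightarrow> real mat"
  subres :: "nat \<Rightarrow> real vec \<Rightarrow> real vec \<Rightarrow> real vec"
  nport :: nat
  pdof :: "nat \<Rightarrow> nat"
  psubs :: "nat \<Rightarrow> nat set"
  Pport :: "nat \<Rightarrow> real mat"
  Ploc :: "nat \<Rightarrow> nat \<Rightarrow> real mat"

text \<open>
  \<open>nint\<close>, \<open>nifc\<close>, \<open>nres\<close> and \<open>Pint\<close>, \<open>Pifc\<close>, \<open>Pres\<close> are the sizes and sampling matrices of the interior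
  states, interface states and residual entries of each subdomain, and \<open>subres i\<close> takes an interior
  and an interface state. \<open>psubs j\<close> is the set of subdomains sharing port \<open>j\<close>; \<open>Pport j\<close> extracts port \<open>j\<close>
  from the global state, \<open>Ploc i j\<close> from the interface state of subdomain \<open>i\<close>.
\<close>

definition ports_of :: "dd_system \<Rightarrow> nat \<Rightarrow> nat set" where
  "ports_of D i = {j. j < nport D \<and> i \<in> psubs D j}"

definition sampled :: "real mat \<Rightarrow> nat set" where
  "sampled P = {k. k < dim_col P \<and> (\<exists>a<dim_row P. P $$ (a, k) = 1)}"

fun segment :: "dd_system \<Rightarrow> nat + nat \<Rightarrow> nat set" where
  "segment D (Inl i) = sampled (Pint D i)"
| "segment D (Inr j) = sampled (Pport D j)"

definition valid_subdomains :: "dd_system \<Rightarrow> bool" where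
  "valid_subdomains D \<longleftrightarrow>
     0 < nsub D \<and>
     (\<forall>i<nsub D.
        sampling_matrix (nint D i) (ndof D) (Pint D i) \<and>
        sampling_matrix (nifc D i) (ndof D) (Pifc D i) \<and>
        sampling_matrix (nres D i) (ndof D) (Pres D i) \<and>
        (\<forall>y \<in> carrier_vec (nint D i). \<forall>z \<in> carrier_vec (nifc D i).
           subres D i y z \<in> carrier_vec (nres D i))) \<and>
     (\<forall>i<nsub D. \<forall>j<nsub D. i \<noteq> j \<longrightarrow>
        Pres D i * transpose_mat (Pres D j) = 0\<^sub>m (nres D i) (nres D j) \<and>
        Pint D i * transpose_mat (Pint D j) = 0\<^sub>m (nint D i) (nint D j)) \<and>
     (\<Sum>i<nsub D. nres D i) = ndof D"

definition valid_ports :: "dd_system \<Rightarrow> bool" where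
  "valid_ports D \<longleftrightarrow>
     (\<forall>j<nport D.
        psubs D j \<subseteq> {..<nsub D} \<and>
        sampling_matrix (pdof D j) (ndof D) (Pport D j) \<and>
        (\<forall>i \<in> psubs D j.
           sampling_matrix (pdof D j) (nifc D i) (Ploc D i j) \<and>
           Ploc D i j * Pifc D i = Pport D j)) \<and>
     (\<forall>i<nsub D.
        (\<forall>j \<in> ports_of D i. \<forall>l \<in> ports_of D i. j \<noteq> l \<longrightarrow>
           Ploc D i j * transpose_mat (Ploc D i l) = 0\<^sub>m (pdof D j) (pdof D l)) \<and>
        (\<Sum>j \<in> ports_of D i. pdof D j) = nifc D i) \<and>
     disjoint_family_on (segment D) ({..<nsub D} <+> {..<nport D}) \<and>
     (\<Union>s \<in> {..<nsub D} <+> {..<nport D}. segment D s) = {..<ndof D}"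

definition valid_system :: "dd_system \<Rightarrow> bool" where
  "valid_system D \<longleftrightarrow> valid_subdomains D \<and> valid_ports D"

definition local_residual :: "dd_system \<Rightarrow> nat \<Rightarrow> real vec \<Rightarrow> real vec" where
  "local_residual D i w = subres D i (Pint D i *\<^sub>v w) (Pifc D i *\<^sub>v w)"

definition assembled_residual :: "dd_system \<Rightarrow> real vec \<Rightarrow> real vec" where
  "assembled_residual D w =
     finsum_vec TYPE(real) (ndof D)
       (\<lambda>i. transpose_mat (Pres D i) *\<^sub>v local_residual D i w) {..<nsub D}"

text \<open>The row count is computed over the integers, as \<open>card (psubs D j) - 1\<close> would truncate on \<open>nat\<close>.\<close>

definition strong_constraints :: "dd_system \<Rightarrow> nat \<Rightarrow> (nat \<Rightarrow> real mat) \<Rightarrow> bool" where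
  "strong_constraints D nAbar Abar \<longleftrightarrow>
     int nAbar = (\<Sum>j<nport D. (int (card (psubs D j)) - 1) * int (pdof D j)) \<and>
     (\<forall>i<nsub D. Abar i \<in> carrier_mat nAbar (nifc D i) \<and> elements_mat (Abar i) \<subseteq> {-1, 0, 1}) \<and>
     (\<forall>y. (\<forall>i<nsub D. y i \<in> carrier_vec (nifc D i)) \<longrightarrow>
        (finsum_vec TYPE(real) nAbar (\<lambda>i. Abar i *\<^sub>v y i) {..<nsub D} = 0\<^sub>v nAbar \<longleftrightarrow>
         (\<forall>j<nport D. \<forall>i \<in> psubs D j. \<forall>l \<in> psubs D j. Ploc D i j *\<^sub>v y i = Ploc D l j *\<^sub>v y l)))"

text \<open>
  The largest Euclidean distance of two global states over all segments. The maximum is taken over one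
  joint set, so that it also makes sense when there are no ports.
\<close>

definition segment_dist :: "dd_system \<Rightarrow> real vec \<Rightarrow> real vec \<Rightarrow> real" where
  "segment_dist D x y =
     Max ((\<lambda>i. norm2 (Pint D i *\<^sub>v x - Pint D i *\<^sub>v y)) ` {..<nsub D} \<union>
          (\<lambda>j. norm2 (Pport D j *\<^sub>v x - Pport D j *\<^sub>v y)) ` {..<nport D})"

section \<open>Reduced bases\<close>

text \<open>
  Either separate interior and interface bases, or one basis per subdomain, whose rows are ordered
  with the interior degrees of freedom before the interface ones. The reduced dimensions are the
  column counts.
\<close>

datatype rom_bases =
  Interior_Boundary "nat \<Rightarrow> real mat" "nat \<Rightarrow> real mat"
| Full_Subdomain "nat \<Rightarrow> real mat"

fun valid_bases :: "dd_system \<Rightarrow> rom_bases \<Rightarrow> bool" where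
  "valid_bases D (Interior_Boundary \<Phi>\<Omega> \<Phi>\<Gamma>) \<longleftrightarrow>
     (\<forall>i<nsub D. dim_row (\<Phi>\<Omega> i) = nint D i \<and> full_column_rank (\<Phi>\<Omega> i) \<and>
        dim_row (\<Phi>\<Gamma> i) = nifc D i \<and> full_column_rank (\<Phi>\<Gamma> i))"
| "valid_bases D (Full_Subdomain \<Phi>) \<longleftrightarrow>
     (\<forall>i<nsub D. dim_row (\<Phi> i) = nint D i + nifc D i \<and> full_column_rank (\<Phi> i))"

fun int_basis :: "dd_system \<Rightarrow> rom_bases \<Rightarrow> nat \<Rightarrow> real mat" where
  "int_basis D (Interior_Boundary \<Phi>\<Omega> \<Phi>\<Gamma>) i = \<Phi>\<Omega> i"
| "int_basis D (Full_Subdomain \<Phi>) i =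
     mat (nint D i) (dim_col (\<Phi> i)) (\<lambda>(a, b). \<Phi> i $$ (a, b))"

fun ifc_basis :: "dd_system \<Rightarrow> rom_bases \<Rightarrow> nat \<Rightarrow> real mat" where
  "ifc_basis D (Interior_Boundary \<Phi>\<Omega> \<Phi>\<Gamma>) i = \<Phi>\<Gamma> i"
| "ifc_basis D (Full_Subdomain \<Phi>) i =
     mat (nifc D i) (dim_col (\<Phi> i)) (\<lambda>(a, b). \<Phi> i $$ (nint D i + a, b))"

section \<open>Trial subspaces\<close>

definition coupling_matrix :: "dd_system \<Rightarrow> nat \<Rightarrow> (nat \<Rightarrow> real mat) \<Rightarrow> rom_bases \<Rightarrow> real mat" where
  "coupling_matrix D nA A bs =
     mat_of_cols nA (concat (map (\<lambda>i. cols (A i * ifc_basis D bs i)) [0..<nsub D]))"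

definition ifc_offset :: "dd_system \<Rightarrow> rom_bases \<Rightarrow> nat \<Rightarrow> nat" where
  "ifc_offset D bs i = (\<Sum>k<i. dim_col (ifc_basis D bs k))"

definition null_basis ::
    "dd_system \<Rightarrow> nat \<Rightarrow> (nat \<Rightarrow> real mat) \<Rightarrow> rom_bases \<Rightarrow> real mat \<Rightarrow> bool" where
  "null_basis D nA A bs N \<longleftrightarrow>
     (let p = ifc_offset D bs (nsub D);
          C = coupling_matrix D nA A bs
      in N \<in> carrier_mat p (p - vec_space.rank nA C) \<and>
         distinct (cols N) \<and> kernel.basis p C (set (cols N)))"

definition row_block :: "dd_system \<Rightarrow> rom_bases \<Rightarrow> real mat \<Rightarrow> nat \<Rightarrow> real mat" where
  "row_block D bs N i =
     mat (dim_col (ifc_basis D bs i)) (dim_col N) (\<lambda>(a, b). N $$ (ifc_offset D bs i + a, b))"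

fun trial_subspace :: "dd_system \<Rightarrow> rom_bases \<Rightarrow> real mat \<Rightarrow> real vec set" where
  "trial_subspace D (Interior_Boundary \<Phi>\<Omega> \<Phi>\<Gamma>) N =
     {w \<in> carrier_vec (ndof D).
        \<exists>wI. \<exists>wnull \<in> carrier_vec (dim_col N). \<forall>i<nsub D.
          wI i \<in> carrier_vec (dim_col (\<Phi>\<Omega> i)) \<and>
          Pint D i *\<^sub>v w = \<Phi>\<Omega> i *\<^sub>v wI i \<and>
          Pifc D i *\<^sub>v w =
            \<Phi>\<Gamma> i *\<^sub>v (row_block D (Interior_Boundary \<Phi>\<Omega> \<Phi>\<Gamma>) N i *\<^sub>v wnull)}"
| "trial_subspace D (Full_Subdomain \<Phi>) N =
     {w \<in> carrier_vec (ndof D).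
        \<exists>wnull \<in> carrier_vec (dim_col N). \<forall>i<nsub D.
          Pint D i *\<^sub>v w =
            int_basis D (Full_Subdomain \<Phi>) i *\<^sub>v (row_block D (Full_Subdomain \<Phi>) N i *\<^sub>v wnull) \<and>
          Pifc D i *\<^sub>v w =
            ifc_basis D (Full_Subdomain \<Phi>) i *\<^sub>v (row_block D (Full_Subdomain \<Phi>) N i *\<^sub>v wnull)}"

section \<open>DD-LSPG reduced-order model\<close>

definition lspg_objective ::
    "dd_system \<Rightarrow> (nat \<Rightarrow> real mat) \<Rightarrow> (nat \<Rightarrow> real vec) \<Rightarrow> (nat \<Rightarrow> real vec) \<Rightarrow> real" where
  "lspg_objective D B y z = 1 / 2 * (\<Sum>i<nsub D. (norm2 (B i *\<^sub>v subres D i (y i) (z i)))\<^sup>2)"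

definition lspg_constraint ::
    "dd_system \<Rightarrow> nat \<Rightarrow> (nat \<Rightarrow> real mat) \<Rightarrow> rom_bases \<Rightarrow> (nat \<Rightarrow> real vec) \<Rightarrow> bool" where
  "lspg_constraint D nA A bs w \<longleftrightarrow>
     finsum_vec TYPE(real) nA (\<lambda>i. A i *\<^sub>v (ifc_basis D bs i *\<^sub>v w i)) {..<nsub D} = 0\<^sub>v nA"

definition lspg_solution_ib ::
    "dd_system \<Rightarrow> (nat \<Rightarrow> real mat) \<Rightarrow> nat \<Rightarrow> (nat \<Rightarrow> real mat) \<Rightarrow>
     (nat \<Rightarrow> real mat) \<Rightarrow> (nat \<Rightarrow> real mat) \<Rightarrow> (nat \<Rightarrow> real vec) \<Rightarrow> (nat \<Rightarrow> real vec) \<Rightarrow> bool" where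
  "lspg_solution_ib D B nA A \<Phi>\<Omega> \<Phi>\<Gamma> xI xG \<longleftrightarrow>
     is_arg_min
       (\<lambda>(wI, wG). lspg_objective D B (\<lambda>i. \<Phi>\<Omega> i *\<^sub>v wI i) (\<lambda>i. \<Phi>\<Gamma> i *\<^sub>v wG i))
       (\<lambda>(wI, wG).
          (\<forall>i<nsub D. wI i \<in> carrier_vec (dim_col (\<Phi>\<Omega> i)) \<and> wG i \<in> carrier_vec (dim_col (\<Phi>\<Gamma> i))) \<and>
          lspg_constraint D nA A (Interior_Boundary \<Phi>\<Omega> \<Phi>\<Gamma>) wG)
       (xI, xG)"

definition lspg_solution_full ::
    "dd_system \<Rightarrow> (nat \<Rightarrow> real mat) \<Rightarrow> nat \<Rightarrow> (nat \<Rightarrow> real mat) \<Rightarrow>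
     (nat \<Rightarrow> real mat) \<Rightarrow> (nat \<Rightarrow> real vec) \<Rightarrow> bool" where
  "lspg_solution_full D B nA A \<Phi> x \<longleftrightarrow>
     is_arg_min
       (\<lambda>w. lspg_objective D B
          (\<lambda>i. int_basis D (Full_Subdomain \<Phi>) i *\<^sub>v w i)
          (\<lambda>i. ifc_basis D (Full_Subdomain \<Phi>) i *\<^sub>v w i))
       (\<lambda>w. (\<forall>i<nsub D. w i \<in> carrier_vec (dim_col (\<Phi> i))) \<and>
          lspg_constraint D nA A (Full_Subdomain \<Phi>) w)
       x"

fun global_lspg_solution ::
    "dd_system \<Rightarrow> (nat \<Rightarrow> real mat) \<Rightarrow> nat \<Rightarrow> (nat \<Rightarrow> real mat) \<Rightarrow> rom_bases \<Rightarrow> real vec \<Rightarrow> bool" where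
  "global_lspg_solution D B nA A (Interior_Boundary \<Phi>\<Omega> \<Phi>\<Gamma>) xt \<longleftrightarrow>
     xt \<in> carrier_vec (ndof D) \<and>
     (\<exists>xI xG. lspg_solution_ib D B nA A \<Phi>\<Omega> \<Phi>\<Gamma> xI xG \<and>
        (\<forall>i<nsub D. Pint D i *\<^sub>v xt = \<Phi>\<Omega> i *\<^sub>v xI i \<and> Pifc D i *\<^sub>v xt = \<Phi>\<Gamma> i *\<^sub>v xG i))"
| "global_lspg_solution D B nA A (Full_Subdomain \<Phi>) xt \<longleftrightarrow>
     xt \<in> carrier_vec (ndof D) \<and>
     (\<exists>xh. lspg_solution_full D B nA A \<Phi> xh \<and>
        (\<forall>i<nsub D.
           Pint D i *\<^sub>v xt = int_basis D (Full_Subdomain \<Phi>) i *\<^sub>v xh i \<and>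
           Pifc D i *\<^sub>v xt = ifc_basis D (Full_Subdomain \<Phi>) i *\<^sub>v xh i))"

end

theory Submission
  imports Defs
begin

text \<open>
  The full-order solution annihilates every subdomain residual, because the residual sampling matrices
  are orthogonal to each other and so the assembled residual only juxtaposes the subdomain residuals
  (\<open>assembled_residual_zero_imp_local\<close>). Inverse stability, the bound on the hyper-reduction matrices
  over the trial subspace, optimality of the reduced solution and Lipschitz continuity therefore give,
  for every \<open>w\<close> in the trial subspace,
  \<open>P * \<kappa>l * \<parallel>x - xt\<parallel> \<le> \<parallel>B r(xt)\<parallel> \<le> \<parallel>B r(w)\<parallel> = \<parallel>B r(x) - B r(w)\<parallel> \<le> \<kappa>u * \<parallel>x - w\<parallel>\<close>.
  The segments partition the degrees of freedom, so the squared Euclidean norm is the sum of the squared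
  segment norms. Hence the largest segment norm lies below the Euclidean norm and, up to the square root
  of the number of segments, above it (\<open>segment_norm_le_norm2\<close>, \<open>norm2_le_segment_norm\<close>). This turns the
  chain into the claimed bound.

  The middle step compares the reduced solution with elements of the trial subspace, so both must
  belong to the same feasible set. They do, because the interface coordinates that satisfy the strong
  constraints are exactly those in the range of the null-space basis
  (\<open>lspg_constraint_iff_null_coordinates\<close>, \<open>global_lspg_solution_optimal_on_trial_subspace\<close>).

  That the minimum on the right-hand side is attained rests on the trial subspace being a linear subspace
  of a finite-dimensional space: for every seminorm such a subspace contains a nearest point
  (\<open>linear_subspace_proximinal\<close>). The proof adds one direction at a time, and each addition only
  needs the minimum of a continuous function on a compact interval.
\<close>

section \<open>Euclidean norm\<close>

lemma norm2_sq: "(norm2 v)\<^sup>2 = (\<Sum>k<dim_vec v. (v $ k)\<^sup>2)"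
  by (simp add: norm2_def L2_set_def sum_nonneg)

lemma norm2_nonneg: "0 \<le> norm2 v"
  by (simp add: norm2_def L2_set_nonneg)

lemma norm2_smult: "norm2 (c \<cdot>\<^sub>v v) = \<bar>c\<bar> * norm2 v"
proof (rule power2_eq_imp_eq)
  show "(norm2 (c \<cdot>\<^sub>v v))\<^sup>2 = (\<bar>c\<bar> * norm2 v)\<^sup>2"
    by (simp add: norm2_sq power_mult_distrib sum_distrib_left)
qed (simp_all add: norm2_nonneg)

lemma norm2_add:
  assumes "u \<in> carrier_vec n" and "v \<in> carrier_vec n"
  shows "norm2 (u + v) \<le> norm2 u + norm2 v"
proof -
  have "norm2 (u + v) = L2_set (\<lambda>k. u $ k + v $ k) {..<n}"
    unfolding norm2_def using assms by (intro L2_set_cong) auto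
  also have "\<dots> \<le> norm2 u + norm2 v"
    using L2_set_triangle_ineq[of "\<lambda>k. u $ k" "\<lambda>k. v $ k" "{..<n}"] assms by (simp add: norm2_def)
  finally show ?thesis .
qed

lemma norm2_zero_minus: "dim_vec v = n \<Longrightarrow> norm2 (0\<^sub>v n - v) = norm2 v"
  by (simp add: norm2_def L2_set_def)

section \<open>Sampling matrices\<close>

lemma sampling_matrix_selection:
  assumes "sampling_matrix m n P"
  obtains f where "inj_on f {..<m}" "f ` {..<m} \<subseteq> {..<n}"
    "\<And>a k. a < m \<Longrightarrow> k < n \<Longrightarrow> P $$ (a, k) = (if k = f a then 1 else 0)"
proof -
  have P: "P \<in> carrier_mat m n" and dist: "distinct (rows P)"
    and sub: "set (rows P) \<subseteq> set (rows (1\<^sub>m n))"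
    using assms by (auto simp: sampling_matrix_def)
  have "\<exists>j<n. row P a = row (1\<^sub>m n) j" if "a < m" for a
  proof -
    have "row P a \<in> set (rows P)"
      using that P by (metis carrier_matD(1) in_set_conv_nth length_rows nth_rows)
    then have "row P a \<in> set (rows (1\<^sub>m n))" using sub by blast
    then show ?thesis by (auto simp: in_set_conv_nth)
  qed
  then obtain f where f: "\<And>a. a < m \<Longrightarrow> f a < n \<and> row P a = row (1\<^sub>m n) (f a)"
    by metis
  have "inj_on f {..<m}"
  proof (rule inj_onI)
    fix a b assume a: "a \<in> {..<m}" and b: "b \<in> {..<m}" and "f a = f b"
    then have "rows P ! a = rows P ! b" using f[of a] f[of b] P by simp
    then show "a = b"
      using dist a b P nth_eq_iff_index_eq[of "rows P" a b] by simp
  qed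
  moreover have "f ` {..<m} \<subseteq> {..<n}" using f by auto
  moreover have "P $$ (a, k) = (if k = f a then 1 else 0)" if "a < m" "k < n" for a k
  proof -
    have "P $$ (a, k) = row P a $ k" using that P by simp
    also have "\<dots> = row (1\<^sub>m n) (f a) $ k" using f that by simp
    also have "\<dots> = (if k = f a then 1 else 0)" using f[of a] that by simp
    finally show ?thesis .
  qed
  ultimately show ?thesis using that by blast
qed

lemma selection_mult_vec_index:
  assumes "P \<in> carrier_mat m n" and "v \<in> carrier_vec n" and "a < m" and "j < n"
    and "\<And>k. k < n \<Longrightarrow> P $$ (a, k) = (if k = j then 1 else (0::real))"
  shows "(P *\<^sub>v v) $ a = v $ j"
proof -
  have "(P *\<^sub>v v) $ a = (\<Sum>k\<in>{0..<n}. P $$ (a, k) * v $ k)"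
    using assms(1-3) by (auto simp: scalar_prod_def intro!: sum.cong)
  also have "\<dots> = (\<Sum>k\<in>{0..<n}. if k = j then v $ k else 0)"
    using assms(5) by (intro sum.cong) auto
  also have "\<dots> = v $ j" using assms(4) by simp
  finally show ?thesis .
qed

text \<open>
  The selected positions are distinct, so sampling drops entries but never repeats one.
\<close>

lemma norm2_sampling_sq:
  assumes S: "sampling_matrix m n P" and v: "v \<in> carrier_vec n"
  shows "(norm2 (P *\<^sub>v v))\<^sup>2 = (\<Sum>k\<in>sampled P. (v $ k)\<^sup>2)"
proof -
  have P: "P \<in> carrier_mat m n" using S by (simp add: sampling_matrix_def)
  obtain f where inj: "inj_on f {..<m}" and img: "f ` {..<m} \<subseteq> {..<n}"
    and f: "\<And>a k. a < m \<Longrightarrow> k < n \<Longrightarrow> P $$ (a, k) = (if k = f a then 1 else 0)"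
    using sampling_matrix_selection[OF S] by blast
  have "sampled P = f ` {..<m}"
  proof (intro equalityI subsetI)
    fix k assume "k \<in> sampled P"
    then obtain a where "a < m" "k < n" "P $$ (a, k) = 1" using P by (auto simp: sampled_def)
    then show "k \<in> f ` {..<m}" using f[of a k] by (auto split: if_splits)
  next
    fix k assume "k \<in> f ` {..<m}"
    then obtain a where a: "a < m" "k = f a" by blast
    then have "k < n" using img by auto
    then show "k \<in> sampled P" using P a f[of a k] by (auto simp: sampled_def)
  qed
  moreover have "(P *\<^sub>v v) $ a = v $ f a" if "a < m" for a
    using selection_mult_vec_index[OF P v that] img f[OF that] that by auto
  ultimately show ?thesis
    using P inj by (simp add: norm2_sq sum.reindex)
qed

lemma subdomain_sampling:
  assumes "valid_subdomains D" and "i < nsub D"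
  shows "sampling_matrix (nint D i) (ndof D) (Pint D i)"
    and "sampling_matrix (nifc D i) (ndof D) (Pifc D i)"
    and "sampling_matrix (nres D i) (ndof D) (Pres D i)"
proof -
  have "sampling_matrix (nint D i) (ndof D) (Pint D i) \<and>
      sampling_matrix (nifc D i) (ndof D) (Pifc D i) \<and>
      sampling_matrix (nres D i) (ndof D) (Pres D i)"
    using assms unfolding valid_subdomains_def by (elim conjE) simp
  then show "sampling_matrix (nint D i) (ndof D) (Pint D i)"
    and "sampling_matrix (nifc D i) (ndof D) (Pifc D i)"
    and "sampling_matrix (nres D i) (ndof D) (Pres D i)" by simp_all
qed

lemma sampling_matrix_carrier: "sampling_matrix m n P \<Longrightarrow> P \<in> carrier_mat m n"
  by (simp add: sampling_matrix_def)

lemma local_residual_carrier: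
  assumes "valid_subdomains D" and "x \<in> carrier_vec (ndof D)" and "j < nsub D"
  shows "local_residual D j x \<in> carrier_vec (nres D j)"
proof -
  have "Pint D j *\<^sub>v x \<in> carrier_vec (nint D j)" "Pifc D j *\<^sub>v x \<in> carrier_vec (nifc D j)"
    using subdomain_sampling[OF assms(1,3)] assms(2)
    by (auto intro: mult_mat_vec_carrier sampling_matrix_carrier)
  then show ?thesis using assms(1,3) unfolding valid_subdomains_def local_residual_def by blast
qed

text \<open>
  An entry selected both by subdomain \<open>i\<close> and by another subdomain would show up as an entry 1 in the
  product of their sampling matrices. Each entry of the assembled residual thus receives the
  contribution of a single subdomain, and no cancellation can occur.
\<close>

lemma assembled_residual_zero_imp_local:
  assumes valid: "valid_subdomains D" and x: "x \<in> carrier_vec (ndof D)"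
    and zero: "assembled_residual D x = 0\<^sub>v (ndof D)" and i: "i < nsub D"
  shows "local_residual D i x = 0\<^sub>v (nres D i)"
proof (rule eq_vecI)
  note smp = subdomain_sampling(3)[OF valid]
  note carP = sampling_matrix_carrier[OF smp]
  have carr: "local_residual D j x \<in> carrier_vec (nres D j)" if "j < nsub D" for j
    by (rule local_residual_carrier[OF valid x that])
  show "dim_vec (local_residual D i x) = dim_vec (0\<^sub>v (nres D i))"
    using carr[OF i] by simp
  fix a assume "a < dim_vec (0\<^sub>v (nres D i))"
  then have a: "a < nres D i" by simp
  obtain f where inj: "inj_on f {..<nres D i}" and img: "f ` {..<nres D i} \<subseteq> {..<ndof D}"
    and f: "\<And>a k. a < nres D i \<Longrightarrow> k < ndof D \<Longrightarrow> Pres D i $$ (a, k) = (if k = f a then 1 else 0)"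
    using sampling_matrix_selection[OF smp[OF i]] by blast
  have fa: "f a < ndof D" using img a by auto
  have orth: "Pres D j $$ (b, f a) = 0" if j: "j < nsub D" "j \<noteq> i" and b: "b < nres D j" for j b
  proof -
    have "0 = (Pres D j * transpose_mat (Pres D i)) $$ (b, a)"
      using valid i j a b by (simp add: valid_subdomains_def)
    also have "\<dots> = (Pres D i *\<^sub>v row (Pres D j) b) $ a"
      using carP[OF i] carP[OF j(1)] a b
      by (simp add: comm_scalar_prod[of "row (Pres D j) b" "ndof D"])
    also have "\<dots> = row (Pres D j) b $ f a"
      using carP[OF i] carP[OF j(1)] a b fa f by (intro selection_mult_vec_index) auto
    finally show ?thesis using carP[OF j(1)] b fa by simp
  qed
  have term_j: "(transpose_mat (Pres D j) *\<^sub>v local_residual D j x) $ f a =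
      (if j = i then local_residual D i x $ a else 0)" if j: "j < nsub D" for j
  proof -
    have "(transpose_mat (Pres D j) *\<^sub>v local_residual D j x) $ f a =
        (\<Sum>b\<in>{0..<nres D j}. Pres D j $$ (b, f a) * local_residual D j x $ b)"
      using carP[OF j] carr[OF j] fa by (auto simp: scalar_prod_def intro!: sum.cong)
    also have "\<dots> = (\<Sum>b\<in>{0..<nres D j}. if j = i \<and> b = a then local_residual D i x $ a else 0)"
    proof (rule sum.cong)
      fix b assume b: "b \<in> {0..<nres D j}"
      show "Pres D j $$ (b, f a) * local_residual D j x $ b =
          (if j = i \<and> b = a then local_residual D i x $ a else 0)"
      proof (cases "j = i")
        case True
        then have bi: "b < nres D i" using b by simp
        have "f a = f b \<longleftrightarrow> b = a" using inj a bi by (auto dest: inj_onD)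
        then show ?thesis using True f[OF bi fa] by auto
      next
        case False
        then show ?thesis using orth[OF j False, of b] b by simp
      qed
    qed simp
    also have "\<dots> = (if j = i then local_residual D i x $ a else 0)"
      using a by (cases "j = i") auto
    finally show ?thesis .
  qed
  have "0 = assembled_residual D x $ f a" using zero fa by simp
  also have "\<dots> = (\<Sum>j<nsub D. (transpose_mat (Pres D j) *\<^sub>v local_residual D j x) $ f a)"
    unfolding assembled_residual_def
  proof (rule index_finsum_vec[OF _ fa])
    show "(\<lambda>j. transpose_mat (Pres D j) *\<^sub>v local_residual D j x) \<in> {..<nsub D} \<rightarrow> carrier_vec (ndof D)"
      using carP carr by (auto intro!: mult_mat_vec_carrier)
  qed simp
  also have "\<dots> = (\<Sum>j<nsub D. if j = i then local_residual D i x $ a else 0)"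
    using term_j by (intro sum.cong) auto
  also have "\<dots> = local_residual D i x $ a" using i by simp
  finally show "local_residual D i x $ a = 0\<^sub>v (nres D i) $ a" using a by simp
qed

section \<open>Segments\<close>

definition segment_matrix :: "dd_system \<Rightarrow> nat + nat \<Rightarrow> real mat" where
  "segment_matrix D = case_sum (Pint D) (Pport D)"

abbreviation segments :: "dd_system \<Rightarrow> (nat + nat) set" where
  "segments D \<equiv> {..<nsub D} <+> {..<nport D}"

text \<open>
  The seminorm behind \<open>segment_dist\<close>. The interiors and ports are indexed jointly, as in \<open>segment\<close>, so that
  both kinds of segments are treated at once.
\<close>

definition segment_norm :: "dd_system \<Rightarrow> real vec \<Rightarrow> real" where
  "segment_norm D v = (MAX s\<in>segments D. norm2 (segment_matrix D s *\<^sub>v v))"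

lemma sampled_segment_matrix: "sampled (segment_matrix D s) = segment D s"
  by (cases s) (simp_all add: segment_matrix_def)

lemma segment_matrix_sampling:
  assumes "valid_system D" and "s \<in> segments D"
  obtains m where "sampling_matrix m (ndof D) (segment_matrix D s)"
proof (cases s)
  case (Inl i)
  then have "i < nsub D" using assms(2) by auto
  then show ?thesis
    using subdomain_sampling(1)[of D i] assms(1) that Inl
    by (simp add: segment_matrix_def valid_system_def)
next
  case (Inr j)
  then have "j < nport D" using assms(2) by auto
  then have "sampling_matrix (pdof D j) (ndof D) (Pport D j)"
    using assms(1) unfolding valid_system_def valid_ports_def by blast
  then show ?thesis using that Inr by (simp add: segment_matrix_def)
qed

lemma segment_matrix_carrier:
  assumes "valid_system D" and "s \<in> segments D"
  shows "segment_matrix D s \<in> carrier_mat (dim_row (segment_matrix D s)) (ndof D)"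
proof -
  from assms obtain m where "sampling_matrix m (ndof D) (segment_matrix D s)"
    by (rule segment_matrix_sampling)
  from sampling_matrix_carrier[OF this] show ?thesis by (metis carrier_matD(1))
qed

lemma segments_nonempty: "valid_system D \<Longrightarrow> segments D \<noteq> {}"
  by (auto simp: valid_system_def valid_subdomains_def)

lemma norm2_segment_le: "s \<in> segments D \<Longrightarrow> norm2 (segment_matrix D s *\<^sub>v v) \<le> segment_norm D v"
  unfolding segment_norm_def by (intro Max_ge) auto

lemma segment_norm_leI:
  assumes "valid_system D" and "\<And>s. s \<in> segments D \<Longrightarrow> norm2 (segment_matrix D s *\<^sub>v v) \<le> b"
  shows "segment_norm D v \<le> b"
  unfolding segment_norm_def
  using assms(2) segments_nonempty[OF assms(1)] by (intro Max.boundedI) auto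

lemma segment_norm_nonneg:
  assumes "valid_system D"
  shows "0 \<le> segment_norm D v"
proof -
  obtain s where "s \<in> segments D" using segments_nonempty[OF assms] by blast
  from norm2_segment_le[OF this, of v] show ?thesis
    using norm2_nonneg[of "segment_matrix D s *\<^sub>v v"] by linarith
qed

lemma segment_dist_eq_segment_norm:
  assumes valid: "valid_system D" and x: "x \<in> carrier_vec (ndof D)" and y: "y \<in> carrier_vec (ndof D)"
  shows "segment_dist D x y = segment_norm D (x - y)"
proof -
  have "segment_dist D x y
      = (MAX s\<in>segments D. norm2 (segment_matrix D s *\<^sub>v x - segment_matrix D s *\<^sub>v y))"
    unfolding segment_dist_def segment_matrix_def by (simp add: Plus_def image_Un image_image)
  also have "\<dots> = segment_norm D (x - y)"
    unfolding segment_norm_def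
  proof (intro arg_cong[where f = Max] image_cong refl)
    fix s assume "s \<in> segments D"
    then show "norm2 (segment_matrix D s *\<^sub>v x - segment_matrix D s *\<^sub>v y)
        = norm2 (segment_matrix D s *\<^sub>v (x - y))"
      using mult_minus_distrib_mat_vec[OF segment_matrix_carrier[OF valid] x y] by simp
  qed
  finally show ?thesis .
qed

text \<open>
  The segments are disjoint and cover all degrees of freedom, so this is a regrouping of the sum of
  squares.
\<close>

lemma norm2_eq_sum_segments:
  assumes valid: "valid_system D" and v: "v \<in> carrier_vec (ndof D)"
  shows "(norm2 v)\<^sup>2 = (\<Sum>s\<in>segments D. (norm2 (segment_matrix D s *\<^sub>v v))\<^sup>2)"
proof -
  have disj: "disjoint_family_on (segment D) (segments D)"
    and cover: "(\<Union>s\<in>segments D. segment D s) = {..<ndof D}"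
    using valid by (simp_all add: valid_system_def valid_ports_def)
  have fseg: "finite (segment D s)" if "s \<in> segments D" for s
    using cover that by (metis UN_upper finite_lessThan finite_subset)
  have "(norm2 v)\<^sup>2 = (\<Sum>k\<in>(\<Union>s\<in>segments D. segment D s). (v $ k)\<^sup>2)"
    unfolding cover using v by (simp add: norm2_sq)
  also have "\<dots> = (\<Sum>s\<in>segments D. \<Sum>k\<in>segment D s. (v $ k)\<^sup>2)"
    using fseg disj by (intro sum.UNION_disjoint) (auto simp: disjoint_family_on_def)
  also have "\<dots> = (\<Sum>s\<in>segments D. (norm2 (segment_matrix D s *\<^sub>v v))\<^sup>2)"
  proof (rule sum.cong)
    fix s assume "s \<in> segments D"
    with valid obtain m where "sampling_matrix m (ndof D) (segment_matrix D s)"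
      by (rule segment_matrix_sampling)
    then show "(\<Sum>k\<in>segment D s. (v $ k)\<^sup>2) = (norm2 (segment_matrix D s *\<^sub>v v))\<^sup>2"
      using norm2_sampling_sq[OF _ v] by (simp add: sampled_segment_matrix)
  qed simp
  finally show ?thesis .
qed

lemma segment_norm_le_norm2:
  assumes valid: "valid_system D" and v: "v \<in> carrier_vec (ndof D)"
  shows "segment_norm D v \<le> norm2 v"
proof (rule segment_norm_leI[OF valid])
  fix s assume s: "s \<in> segments D"
  have "(norm2 (segment_matrix D s *\<^sub>v v))\<^sup>2 \<le> (norm2 v)\<^sup>2"
    unfolding norm2_eq_sum_segments[OF valid v] by (rule member_le_sum[OF s]) auto
  then show "norm2 (segment_matrix D s *\<^sub>v v) \<le> norm2 v"
    by (rule power2_le_imp_le) (rule norm2_nonneg)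
qed

lemma norm2_le_segment_norm:
  assumes valid: "valid_system D" and v: "v \<in> carrier_vec (ndof D)"
  shows "norm2 v \<le> sqrt (real (nsub D + nport D)) * segment_norm D v"
proof (rule power2_le_imp_le)
  have "(norm2 v)\<^sup>2 \<le> (\<Sum>s\<in>segments D. (segment_norm D v)\<^sup>2)"
    unfolding norm2_eq_sum_segments[OF valid v]
    by (intro sum_mono power_mono norm2_segment_le norm2_nonneg)
  then show "(norm2 v)\<^sup>2 \<le> (sqrt (real (nsub D + nport D)) * segment_norm D v)\<^sup>2"
    by (simp add: power_mult_distrib card_Plus)
  show "0 \<le> sqrt (real (nsub D + nport D)) * segment_norm D v"
    using segment_norm_nonneg[OF valid] by simp
qed

section \<open>Nearest points in a subspace\<close>

text \<open>
  Homogeneity is only required as an inequality: it yields the equality (use the reciprocal scalar), and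
  it is easier to verify for a seminorm that is itself defined by a minimum.
\<close>

definition seminorm_on :: "nat \<Rightarrow> (real vec \<Rightarrow> real) \<Rightarrow> bool" where
  "seminorm_on n q \<longleftrightarrow>
     (\<forall>u \<in> carrier_vec n. \<forall>v \<in> carrier_vec n. q (u + v) \<le> q u + q v) \<and>
     (\<forall>c. \<forall>v \<in> carrier_vec n. q (c \<cdot>\<^sub>v v) \<le> \<bar>c\<bar> * q v)"

text \<open>
  The quantification over all seminorms, rather than over one, is what makes the induction below work:
  adding a direction to the set is traded for a change of the seminorm.
\<close>

definition proximinal :: "nat \<Rightarrow> real vec set \<Rightarrow> bool" where
  "proximinal n T \<longleftrightarrow>
     (\<forall>q. seminorm_on n q \<longrightarrow> (\<forall>z \<in> carrier_vec n. \<exists>s \<in> T. \<forall>w \<in> T. q (z - s) \<le> q (z - w)))"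

definition linear_subspace :: "nat \<Rightarrow> real vec set \<Rightarrow> bool" where
  "linear_subspace n T \<longleftrightarrow> T \<subseteq> carrier_vec n \<and> 0\<^sub>v n \<in> T \<and>
     (\<forall>u \<in> T. \<forall>v \<in> T. \<forall>c. u + c \<cdot>\<^sub>v v \<in> T)"

lemma seminorm_add:
  "seminorm_on n q \<Longrightarrow> u \<in> carrier_vec n \<Longrightarrow> v \<in> carrier_vec n \<Longrightarrow> q (u + v) \<le> q u + q v"
  by (simp add: seminorm_on_def)

lemma seminorm_smult: "seminorm_on n q \<Longrightarrow> v \<in> carrier_vec n \<Longrightarrow> q (c \<cdot>\<^sub>v v) \<le> \<bar>c\<bar> * q v"
  by (simp add: seminorm_on_def)

lemma seminorm_nonneg:
  assumes q: "seminorm_on n q" and v: "v \<in> carrier_vec n"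
  shows "0 \<le> q v"
proof -
  have "q (0\<^sub>v n + 0\<^sub>v n) \<le> q (0\<^sub>v n) + q (0\<^sub>v n)" using q by (intro seminorm_add) auto
  then have "0 \<le> q (0\<^sub>v n)" by simp
  also have "0\<^sub>v n = v + (-1) \<cdot>\<^sub>v v" using v by auto
  also have "q (v + (-1) \<cdot>\<^sub>v v) \<le> q v + q ((-1) \<cdot>\<^sub>v v)" using q v by (intro seminorm_add) auto
  also have "q ((-1) \<cdot>\<^sub>v v) \<le> q v" using seminorm_smult[OF q v, of "-1"] by simp
  finally show ?thesis by simp
qed

text \<open>
  A seminorm that vanishes on \<open>v\<close> is constant along the line. Otherwise it is Lipschitz along the line
  and grows linearly at both ends, so that it suffices to minimise over a compact interval.
\<close>

lemma seminorm_min_on_line: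
  assumes q: "seminorm_on n q" and v: "v \<in> carrier_vec n" and z: "z \<in> carrier_vec n"
  shows "\<exists>t. \<forall>s. q (z - t \<cdot>\<^sub>v v) \<le> q (z - s \<cdot>\<^sub>v v)"
proof -
  let ?g = "\<lambda>t. q (z - t \<cdot>\<^sub>v v)"
  have diff: "?g t \<le> ?g s + \<bar>t - s\<bar> * q v" for t s
  proof -
    have "z - t \<cdot>\<^sub>v v = (z - s \<cdot>\<^sub>v v) + (s - t) \<cdot>\<^sub>v v"
      using z v by (intro eq_vecI) (auto simp: algebra_simps)
    then have "?g t \<le> ?g s + q ((s - t) \<cdot>\<^sub>v v)"
      using seminorm_add[OF q, of "z - s \<cdot>\<^sub>v v" "(s - t) \<cdot>\<^sub>v v"] z v by simp
    also have "q ((s - t) \<cdot>\<^sub>v v) \<le> \<bar>t - s\<bar> * q v"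
      using seminorm_smult[OF q v, of "s - t"] by (simp add: abs_minus_commute)
    finally show ?thesis by simp
  qed
  have g0: "?g 0 = q z" using z v by (intro arg_cong[where f = q]) (auto simp: smult_vec_def)
  show ?thesis
  proof (cases "q v = 0")
    case True
    then have "?g 0 \<le> ?g s" for s using diff[of 0 s] by simp
    then show ?thesis by blast
  next
    case False
    then have qv: "0 < q v" using seminorm_nonneg[OF q v] by simp
    have far: "\<bar>t\<bar> * q v - q z \<le> ?g t" for t
    proof -
      have "t \<cdot>\<^sub>v v = z + (-1) \<cdot>\<^sub>v (z - t \<cdot>\<^sub>v v)"
        using z v by (intro eq_vecI) auto
      then have "q (t \<cdot>\<^sub>v v) \<le> q z + q ((-1) \<cdot>\<^sub>v (z - t \<cdot>\<^sub>v v))"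
        using seminorm_add[OF q z, of "(-1) \<cdot>\<^sub>v (z - t \<cdot>\<^sub>v v)"] z v by simp
      also have "q ((-1) \<cdot>\<^sub>v (z - t \<cdot>\<^sub>v v)) \<le> ?g t"
        using seminorm_smult[OF q, of "z - t \<cdot>\<^sub>v v" "-1"] z v by simp
      finally have up: "q (t \<cdot>\<^sub>v v) \<le> q z + ?g t" by simp
      have "\<bar>t\<bar> * q v \<le> q (t \<cdot>\<^sub>v v)"
      proof (cases "t = 0")
        case True
        then show ?thesis using seminorm_nonneg[OF q, of "t \<cdot>\<^sub>v v"] v by simp
      next
        case False
        then have "(1 / t) \<cdot>\<^sub>v (t \<cdot>\<^sub>v v) = v" by (simp add: smult_smult_assoc)
        then have "q v \<le> \<bar>1 / t\<bar> * q (t \<cdot>\<^sub>v v)"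
          using seminorm_smult[OF q, of "t \<cdot>\<^sub>v v" "1 / t"] v by simp
        then show ?thesis using False by (simp add: field_simps abs_divide)
      qed
      then show ?thesis using up by linarith
    qed
    \<comment> \<open>Outside of the interval with this radius, the lower bound \<open>far\<close> already exceeds the value at 0.\<close>
    define R where "R = 2 * q z / q v"
    have R: "0 \<le> R" using qv seminorm_nonneg[OF q z] by (simp add: R_def)
    have "isCont ?g t" for t
      unfolding isCont_def
    proof (rule LIM_I)
      fix e :: real assume "0 < e"
      show "\<exists>d>0. \<forall>s. s \<noteq> t \<and> norm (s - t) < d \<longrightarrow> norm (?g s - ?g t) < e"
      proof (intro exI[of _ "e / q v"] conjI allI impI)
        show "0 < e / q v" using \<open>0 < e\<close> qv by simp
        fix s assume "s \<noteq> t \<and> norm (s - t) < e / q v"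
        then have "\<bar>s - t\<bar> * q v < e" using qv by (simp add: field_simps)
        then show "norm (?g s - ?g t) < e"
          using diff[of s t] diff[of t s] by (simp add: abs_minus_commute abs_less_iff)
      qed
    qed
    then have "continuous_on {-R..R} ?g" by (simp add: continuous_at_imp_continuous_on)
    then obtain t where t: "t \<in> {-R..R}" "\<And>s. s \<in> {-R..R} \<Longrightarrow> ?g t \<le> ?g s"
      using continuous_attains_inf[of "{-R..R}" ?g] R by auto
    have "?g t \<le> ?g s" for s
    proof (cases "s \<in> {-R..R}")
      case False
      then have "R \<le> \<bar>s\<bar>" by auto
      then have "2 * q z \<le> \<bar>s\<bar> * q v" using qv by (simp add: R_def field_simps)
      then have "q z \<le> ?g s" using far[of s] by simp
      then show ?thesis using t(2)[of 0] g0 R by simp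
    qed (use t in blast)
    then show ?thesis by blast
  qed
qed

text \<open>
  Minimise along the line first. The minimal value \<open>q'\<close> is again a seminorm, the distance modulo \<open>v\<close>,
  and a point of \<open>T\<close> nearest in \<open>q'\<close>, shifted optimally along \<open>v\<close>, is nearest in \<open>q\<close>.
\<close>

lemma proximinal_add_line:
  assumes T: "proximinal n T" and sub: "T \<subseteq> carrier_vec n" and v: "v \<in> carrier_vec n"
  shows "proximinal n {u + t \<cdot>\<^sub>v v | u t. u \<in> T}"
  unfolding proximinal_def
proof (intro allI impI ballI)
  fix q and z :: "real vec" assume q: "seminorm_on n q" and z: "z \<in> carrier_vec n"
  obtain \<tau> where \<tau>: "\<And>y s. y \<in> carrier_vec n \<Longrightarrow> q (y - \<tau> y \<cdot>\<^sub>v v) \<le> q (y - s \<cdot>\<^sub>v v)"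
    using seminorm_min_on_line[OF q v] by metis
  define q' where "q' y = q (y - \<tau> y \<cdot>\<^sub>v v)" for y
  have q'_le: "q' y \<le> q (y - s \<cdot>\<^sub>v v)" if "y \<in> carrier_vec n" for y s
    using \<tau> that by (simp add: q'_def)
  have "seminorm_on n q'"
    unfolding seminorm_on_def
  proof (intro conjI ballI allI)
    fix a b :: "real vec" assume a: "a \<in> carrier_vec n" and b: "b \<in> carrier_vec n"
    have "q' (a + b) \<le> q (a + b - (\<tau> a + \<tau> b) \<cdot>\<^sub>v v)" using a b by (intro q'_le) auto
    also have "a + b - (\<tau> a + \<tau> b) \<cdot>\<^sub>v v = (a - \<tau> a \<cdot>\<^sub>v v) + (b - \<tau> b \<cdot>\<^sub>v v)"
      using a b v by (intro eq_vecI) (auto simp: algebra_simps)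
    also have "q \<dots> \<le> q' a + q' b"
      unfolding q'_def using a b v by (intro seminorm_add[OF q]) auto
    finally show "q' (a + b) \<le> q' a + q' b" .
  next
    fix c and a :: "real vec" assume a: "a \<in> carrier_vec n"
    have "q' (c \<cdot>\<^sub>v a) \<le> q (c \<cdot>\<^sub>v a - (c * \<tau> a) \<cdot>\<^sub>v v)" using a by (intro q'_le) auto
    also have "c \<cdot>\<^sub>v a - (c * \<tau> a) \<cdot>\<^sub>v v = c \<cdot>\<^sub>v (a - \<tau> a \<cdot>\<^sub>v v)"
      using a v by (intro eq_vecI) (auto simp: algebra_simps)
    also have "q \<dots> \<le> \<bar>c\<bar> * q' a"
      unfolding q'_def using a v by (intro seminorm_smult[OF q]) auto
    finally show "q' (c \<cdot>\<^sub>v a) \<le> \<bar>c\<bar> * q' a" .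
  qed
  then obtain s where s: "s \<in> T" "\<And>w. w \<in> T \<Longrightarrow> q' (z - s) \<le> q' (z - w)"
    using T z unfolding proximinal_def by blast
  let ?p = "s + \<tau> (z - s) \<cdot>\<^sub>v v"
  have shift: "z - (u + t \<cdot>\<^sub>v v) = z - u - t \<cdot>\<^sub>v v" if "u \<in> T" for u t
    using z v sub that by (intro eq_vecI) auto
  have "q (z - ?p) \<le> q (z - (u + t \<cdot>\<^sub>v v))" if "u \<in> T" for u t
  proof -
    have "q (z - ?p) = q' (z - s)" using shift[OF s(1)] by (simp add: q'_def)
    also have "\<dots> \<le> q' (z - u)" by (rule s(2)[OF that])
    also have "\<dots> \<le> q (z - u - t \<cdot>\<^sub>v v)" using z that sub by (intro q'_le) auto
    finally show ?thesis using shift[OF that] by simp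
  qed
  then show "\<exists>p\<in>{u + t \<cdot>\<^sub>v v | u t. u \<in> T}. \<forall>w\<in>{u + t \<cdot>\<^sub>v v | u t. u \<in> T}. q (z - p) \<le> q (z - w)"
    using s(1) by blast
qed

text \<open>
  Filter the subspace by the number of leading entries that vanish. The last step of the filtration is
  the zero space, and each step exceeds the next one by at most one direction: any element \<open>v\<close> whose
  entry \<open>k\<close> is nonzero can be used to clear that entry in all the others.
\<close>

lemma linear_subspace_proximinal:
  assumes T: "linear_subspace n T"
  shows "proximinal n T"
proof -
  define U where "U k = {w \<in> T. \<forall>i<k. w $ i = 0}" for k
  have sub: "T \<subseteq> carrier_vec n" and zero: "0\<^sub>v n \<in> T"
    and comb: "\<And>u v c. u \<in> T \<Longrightarrow> v \<in> T \<Longrightarrow> u + c \<cdot>\<^sub>v v \<in> T"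
    using T by (auto simp: linear_subspace_def)
  have Usub: "U k \<subseteq> carrier_vec n" for k using sub by (auto simp: U_def)
  have "proximinal n (U k)" if "k \<le> n" for k
    using that
  proof (induction k rule: inc_induct)
    case base
    have "U n = {0\<^sub>v n}" using zero sub by (auto simp: U_def intro!: eq_vecI)
    then show ?case by (simp add: proximinal_def)
  next
    case (step k)
    show ?case
    proof (cases "\<exists>v\<in>U k. v $ k \<noteq> 0")
      case False
      then have "U k = U (Suc k)" by (auto simp: U_def less_Suc_eq)
      then show ?thesis using step by simp
    next
      case True
      then obtain v where v: "v \<in> U k" and vk: "v $ k \<noteq> 0" by blast
      have vn: "dim_vec v = n" using v Usub by (metis carrier_vecD subsetD)
      have "U k = {u + t \<cdot>\<^sub>v v | u t. u \<in> U (Suc k)}"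
      proof (intro equalityI subsetI)
        fix w assume w: "w \<in> U k"
        then have wn: "dim_vec w = n" using Usub by (metis carrier_vecD subsetD)
        let ?t = "w $ k / v $ k"
        have "w + (- ?t) \<cdot>\<^sub>v v \<in> U (Suc k)"
          using w v vk vn wn step comb by (auto simp: U_def less_Suc_eq)
        moreover have "w = (w + (- ?t) \<cdot>\<^sub>v v) + ?t \<cdot>\<^sub>v v"
          using vn wn by (intro eq_vecI) auto
        ultimately show "w \<in> {u + t \<cdot>\<^sub>v v | u t. u \<in> U (Suc k)}" by blast
      next
        fix w assume "w \<in> {u + t \<cdot>\<^sub>v v | u t. u \<in> U (Suc k)}"
        then obtain u t where "w = u + t \<cdot>\<^sub>v v" and u: "u \<in> U (Suc k)" by blast
        moreover have "dim_vec u = n" using u Usub by (metis carrier_vecD subsetD)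
        ultimately show "w \<in> U k" using v vn step comb by (auto simp: U_def)
      qed
      then show ?thesis
        using proximinal_add_line[OF step.IH Usub, of v] v Usub by auto
    qed
  qed
  from this[of 0] show ?thesis by (simp add: U_def)
qed

lemma segment_norm_seminorm:
  assumes valid: "valid_system D"
  shows "seminorm_on (ndof D) (segment_norm D)"
  unfolding seminorm_on_def
proof (intro conjI ballI allI)
  fix u v :: "real vec" assume u: "u \<in> carrier_vec (ndof D)" and v: "v \<in> carrier_vec (ndof D)"
  show "segment_norm D (u + v) \<le> segment_norm D u + segment_norm D v"
  proof (rule segment_norm_leI[OF valid])
    fix s assume s: "s \<in> segments D"
    let ?M = "segment_matrix D s"
    note M = segment_matrix_carrier[OF valid s]
    have "norm2 (?M *\<^sub>v (u + v)) \<le> norm2 (?M *\<^sub>v u) + norm2 (?M *\<^sub>v v)"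
      unfolding mult_add_distrib_mat_vec[OF M u v]
      by (rule norm2_add) (rule mult_mat_vec_carrier[OF M u], rule mult_mat_vec_carrier[OF M v])
    then show "norm2 (?M *\<^sub>v (u + v)) \<le> segment_norm D u + segment_norm D v"
      using norm2_segment_le[OF s, of u] norm2_segment_le[OF s, of v] by linarith
  qed
next
  fix c and v :: "real vec" assume v: "v \<in> carrier_vec (ndof D)"
  show "segment_norm D (c \<cdot>\<^sub>v v) \<le> \<bar>c\<bar> * segment_norm D v"
  proof (rule segment_norm_leI[OF valid])
    fix s assume s: "s \<in> segments D"
    show "norm2 (segment_matrix D s *\<^sub>v (c \<cdot>\<^sub>v v)) \<le> \<bar>c\<bar> * segment_norm D v"
      unfolding mult_mat_vec[OF segment_matrix_carrier[OF valid s] v] norm2_smult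
      by (intro mult_left_mono norm2_segment_le[OF s]) simp
  qed
qed

section \<open>The null space of the coupling matrix\<close>

lemma mult_mat_vec_index_sum:
  "A \<in> carrier_mat m n \<Longrightarrow> v \<in> carrier_vec n \<Longrightarrow> a < m \<Longrightarrow>
    (A *\<^sub>v v) $ a = (\<Sum>b<n. A $$ (a, b) * v $ b)"
  by (auto simp: scalar_prod_def atLeast0LessThan intro!: sum.cong)

lemma kernel_basis_range:
  fixes C :: "real mat"
  assumes C: "C \<in> carrier_mat nr p" and N: "N \<in> carrier_mat p k"
    and basis: "kernel.basis p C (set (cols N))"
  shows "mat_kernel C = {N *\<^sub>v c | c. c \<in> carrier_vec k}"
proof -
  interpret K: kernel nr p C by (unfold_locales) (rule C)
  have sub: "set (cols N) \<subseteq> mat_kernel C" and span: "K.span (set (cols N)) = mat_kernel C"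
    using basis by (simp_all add: K.Ker.basis_def)
  have "mat_kernel C = K.NC.col_space N"
    using K.span_same[OF sub] span by (simp add: K.NC.col_space_def)
  also have "\<dots> = {N *\<^sub>v c | c. c \<in> carrier_vec k}"
    unfolding K.NC.col_space_eq[OF N] using N by auto
  finally show ?thesis .
qed

lemma ifc_offset_Suc: "ifc_offset D bs (Suc i) = ifc_offset D bs i + dim_col (ifc_basis D bs i)"
  by (simp add: ifc_offset_def)

lemma ifc_offset_block_less:
  assumes "i < m" and "a < dim_col (ifc_basis D bs i)"
  shows "ifc_offset D bs i + a < ifc_offset D bs m"
  using assms
  by (induction m) (auto simp: ifc_offset_Suc less_Suc_eq)

text \<open>
  The columns of the coupling matrix are numbered consecutively through the subdomains; the next lemmas
  translate between this numbering and pairs of a subdomain and a local column.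
\<close>

lemma sum_over_blocks:
  fixes f :: "nat \<Rightarrow> 'a :: comm_monoid_add"
  shows "(\<Sum>k<ifc_offset D bs m. f k)
    = (\<Sum>i<m. \<Sum>a<dim_col (ifc_basis D bs i). f (ifc_offset D bs i + a))"
proof (induction m)
  case 0
  then show ?case by (simp add: ifc_offset_def)
next
  case (Suc m)
  have "(\<Sum>k<ifc_offset D bs m + d. f k) = (\<Sum>k<ifc_offset D bs m. f k) + (\<Sum>a<d. f (ifc_offset D bs m + a))" for d
    by (induction d) (simp_all add: add.assoc)
  then show ?case using Suc by (simp add: ifc_offset_Suc)
qed

lemma block_column_length:
  "length (concat (map (\<lambda>i. cols (A i * ifc_basis D bs i)) [0..<m])) = ifc_offset D bs m"
  by (induction m) (simp_all add: ifc_offset_Suc ifc_offset_def)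

lemma block_column_nth:
  assumes "i < m" and "a < dim_col (ifc_basis D bs i)"
  shows "concat (map (\<lambda>i. cols (A i * ifc_basis D bs i)) [0..<m]) ! (ifc_offset D bs i + a)
    = col (A i * ifc_basis D bs i) a"
  using assms
proof (induction m)
  case (Suc m)
  show ?case
  proof (cases "i < m")
    case True
    then show ?thesis
      using Suc ifc_offset_block_less[OF True Suc.prems(2)]
      by (simp add: nth_append block_column_length)
  next
    case False
    then show ?thesis using Suc.prems by (simp add: nth_append block_column_length less_Suc_eq)
  qed
qed simp

lemma stack_blocks_exists:
  fixes z :: "nat \<Rightarrow> real vec"
  obtains v where "v \<in> carrier_vec (ifc_offset D bs m)"
    "\<And>i a. i < m \<Longrightarrow> a < dim_col (ifc_basis D bs i) \<Longrightarrow> v $ (ifc_offset D bs i + a) = z i $ a"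
proof -
  have "\<exists>v \<in> carrier_vec (ifc_offset D bs m). \<forall>i<m. \<forall>a<dim_col (ifc_basis D bs i).
      v $ (ifc_offset D bs i + a) = z i $ a"
  proof (induction m)
    case 0
    then show ?case by (auto intro: zero_carrier_vec)
  next
    case (Suc m)
    then obtain v where v: "v \<in> carrier_vec (ifc_offset D bs m)"
      "\<And>i a. i < m \<Longrightarrow> a < dim_col (ifc_basis D bs i) \<Longrightarrow> v $ (ifc_offset D bs i + a) = z i $ a"
      by blast
    let ?w = "v @\<^sub>v vec (dim_col (ifc_basis D bs m)) (($) (z m))"
    have "?w \<in> carrier_vec (ifc_offset D bs (Suc m))" using v by (simp add: ifc_offset_Suc)
    moreover have "?w $ (ifc_offset D bs i + a) = z i $ a"
      if "i < Suc m" "a < dim_col (ifc_basis D bs i)" for i a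
    proof (cases "i < m")
      case True
      then show ?thesis
        using v that ifc_offset_block_less[OF True that(2)] by simp
    next
      case False
      then show ?thesis using v that by (simp add: less_Suc_eq)
    qed
    ultimately show ?case by blast
  qed
  then show ?thesis using that by blast
qed

lemma coupling_matrix_carrier:
  "coupling_matrix D nA A bs \<in> carrier_mat nA (ifc_offset D bs (nsub D))"
  unfolding coupling_matrix_def using block_column_length by (metis mat_of_cols_carrier(1))

lemma coupling_matrix_cong:
  assumes "\<forall>i<nsub D. A i = A' i"
  shows "coupling_matrix D nA A bs = coupling_matrix D nA A' bs"
proof -
  have "map (\<lambda>i. cols (A i * ifc_basis D bs i)) [0..<nsub D]
      = map (\<lambda>i. cols (A' i * ifc_basis D bs i)) [0..<nsub D]"
    using assms by (intro map_cong) auto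
  then show ?thesis unfolding coupling_matrix_def by (simp only:)
qed

text \<open>
  The coupling matrix applied to the stacked interface coordinates is the left-hand side of the
  constraint.
\<close>

lemma lspg_constraint_iff_kernel:
  assumes A: "\<forall>i<nsub D. A i \<in> carrier_mat nA (nifc D i)"
    and \<Phi>: "\<forall>i<nsub D. dim_row (ifc_basis D bs i) = nifc D i"
    and z: "\<forall>i<nsub D. z i \<in> carrier_vec (dim_col (ifc_basis D bs i))"
    and v: "v \<in> carrier_vec (ifc_offset D bs (nsub D))"
    and blocks: "\<And>i a. i < nsub D \<Longrightarrow> a < dim_col (ifc_basis D bs i) \<Longrightarrow>
      v $ (ifc_offset D bs i + a) = z i $ a"
  shows "lspg_constraint D nA A bs z \<longleftrightarrow> v \<in> mat_kernel (coupling_matrix D nA A bs)"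
proof -
  let ?C = "coupling_matrix D nA A bs"
  let ?d = "\<lambda>i. dim_col (ifc_basis D bs i)"
  let ?sum = "finsum_vec TYPE(real) nA (\<lambda>i. A i *\<^sub>v (ifc_basis D bs i *\<^sub>v z i)) {..<nsub D}"
  have car: "ifc_basis D bs i \<in> carrier_mat (nifc D i) (?d i)" if "i < nsub D" for i
    using \<Phi> that by auto
  have summand: "(\<lambda>i. A i *\<^sub>v (ifc_basis D bs i *\<^sub>v z i)) \<in> {..<nsub D} \<rightarrow> carrier_vec nA"
    using A car z by (auto intro!: mult_mat_vec_carrier)
  have "?C *\<^sub>v v = ?sum"
  proof (rule eq_vecI)
    have dim: "dim_vec ?sum = nA"
      using finsum_vec_closed[OF summand] by simp
    then show "dim_vec (?C *\<^sub>v v) = dim_vec ?sum"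
      using coupling_matrix_carrier[of D nA A bs] by simp
    fix r assume "r < dim_vec ?sum"
    then have r: "r < nA" using dim by simp
    have entry: "?C $$ (r, ifc_offset D bs i + a) = (A i * ifc_basis D bs i) $$ (r, a)"
      if i: "i < nsub D" and a: "a < ?d i" for i a
    proof -
      have Ai: "A i \<in> carrier_mat nA (nifc D i)" using A i by blast
      have "?C $$ (r, ifc_offset D bs i + a) = col (A i * ifc_basis D bs i) a $ r"
        unfolding coupling_matrix_def
        using r ifc_offset_block_less[OF i a]
        by (subst mat_of_cols_index) (simp_all add: block_column_length block_column_nth[OF i a])
      also have "\<dots> = (A i * ifc_basis D bs i) $$ (r, a)"
        by (rule index_col) (use Ai r a in simp_all)
      finally show ?thesis .
    qed
    have "(?C *\<^sub>v v) $ r = (\<Sum>k<ifc_offset D bs (nsub D). ?C $$ (r, k) * v $ k)"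
      by (rule mult_mat_vec_index_sum[OF coupling_matrix_carrier v r])
    also have "\<dots> = (\<Sum>i<nsub D. \<Sum>a<?d i. (A i * ifc_basis D bs i) $$ (r, a) * z i $ a)"
      unfolding sum_over_blocks using entry blocks by simp
    also have "\<dots> = (\<Sum>i<nsub D. (A i *\<^sub>v (ifc_basis D bs i *\<^sub>v z i)) $ r)"
    proof (rule sum.cong)
      fix i assume "i \<in> {..<nsub D}"
      then have i: "i < nsub D" by simp
      have Ai: "A i \<in> carrier_mat nA (nifc D i)" and zi: "z i \<in> carrier_vec (?d i)"
        using A z i by blast+
      have "(\<Sum>a<?d i. (A i * ifc_basis D bs i) $$ (r, a) * z i $ a)
          = ((A i * ifc_basis D bs i) *\<^sub>v z i) $ r"
        by (rule mult_mat_vec_index_sum[OF mult_carrier_mat[OF Ai car[OF i]] zi r, symmetric])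
      also have "(A i * ifc_basis D bs i) *\<^sub>v z i = A i *\<^sub>v (ifc_basis D bs i *\<^sub>v z i)"
        by (rule assoc_mult_mat_vec[OF Ai car[OF i] zi])
      finally show "(\<Sum>a<?d i. (A i * ifc_basis D bs i) $$ (r, a) * z i $ a)
          = (A i *\<^sub>v (ifc_basis D bs i *\<^sub>v z i)) $ r" .
    qed simp
    also have "\<dots> = ?sum $ r"
      by (rule index_finsum_vec[OF _ r summand, symmetric]) simp
    finally show "(?C *\<^sub>v v) $ r = ?sum $ r" .
  qed
  then show ?thesis
    unfolding lspg_constraint_def mat_kernel[OF coupling_matrix_carrier] using v by simp
qed

text \<open>
  The null-space basis parametrises the feasible interface coordinates. This identifies the feasible set
  of the reduced-order model with the coordinates used in the trial subspace.
\<close>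

lemma lspg_constraint_iff_null_coordinates:
  assumes A: "\<forall>i<nsub D. A i \<in> carrier_mat nA (nifc D i)"
    and \<Phi>: "\<forall>i<nsub D. dim_row (ifc_basis D bs i) = nifc D i"
    and N: "null_basis D nA A bs N"
    and z: "\<forall>i<nsub D. z i \<in> carrier_vec (dim_col (ifc_basis D bs i))"
  shows "lspg_constraint D nA A bs z \<longleftrightarrow>
    (\<exists>c \<in> carrier_vec (dim_col N). \<forall>i<nsub D. z i = row_block D bs N i *\<^sub>v c)"
proof -
  let ?p = "ifc_offset D bs (nsub D)"
  have Ncar: "N \<in> carrier_mat ?p (dim_col N)"
    and basis: "kernel.basis ?p (coupling_matrix D nA A bs) (set (cols N))"
    using N by (auto simp: null_basis_def Let_def)
  have kernel: "mat_kernel (coupling_matrix D nA A bs) = {N *\<^sub>v c | c. c \<in> carrier_vec (dim_col N)}"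
    by (rule kernel_basis_range[OF coupling_matrix_carrier Ncar basis])
  have block: "(N *\<^sub>v c) $ (ifc_offset D bs i + a) = (row_block D bs N i *\<^sub>v c) $ a"
    if c: "c \<in> carrier_vec (dim_col N)" and i: "i < nsub D" and a: "a < dim_col (ifc_basis D bs i)"
    for c i a
  proof -
    have "(N *\<^sub>v c) $ (ifc_offset D bs i + a)
        = (\<Sum>b<dim_col N. N $$ (ifc_offset D bs i + a, b) * c $ b)"
      by (rule mult_mat_vec_index_sum[OF Ncar c ifc_offset_block_less[OF i a]])
    also have "\<dots> = (\<Sum>b<dim_col N. row_block D bs N i $$ (a, b) * c $ b)"
      using a by (simp add: row_block_def)
    also have "\<dots> = (row_block D bs N i *\<^sub>v c) $ a"
      by (rule mult_mat_vec_index_sum[OF _ c a, symmetric]) (simp add: row_block_def)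
    finally show ?thesis .
  qed
  show ?thesis
  proof
    assume con: "lspg_constraint D nA A bs z"
    obtain v where v: "v \<in> carrier_vec ?p" and vz: "\<And>i a. i < nsub D \<Longrightarrow>
        a < dim_col (ifc_basis D bs i) \<Longrightarrow> v $ (ifc_offset D bs i + a) = z i $ a"
      using stack_blocks_exists[where m = "nsub D" and z = z] by blast
    then obtain c where c: "c \<in> carrier_vec (dim_col N)" and "v = N *\<^sub>v c"
      using con lspg_constraint_iff_kernel[OF A \<Phi> z v vz] kernel by auto
    then have "z i = row_block D bs N i *\<^sub>v c" if "i < nsub D" for i
      using that z vz[OF that] block[OF c that] by (intro eq_vecI) (auto simp: row_block_def)
    then show "\<exists>c \<in> carrier_vec (dim_col N). \<forall>i<nsub D. z i = row_block D bs N i *\<^sub>v c"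
      using c by blast
  next
    assume "\<exists>c \<in> carrier_vec (dim_col N). \<forall>i<nsub D. z i = row_block D bs N i *\<^sub>v c"
    then obtain c where c: "c \<in> carrier_vec (dim_col N)"
      and zc: "\<And>i. i < nsub D \<Longrightarrow> z i = row_block D bs N i *\<^sub>v c" by blast
    have "N *\<^sub>v c \<in> carrier_vec ?p" using Ncar c by (rule mult_mat_vec_carrier)
    then show "lspg_constraint D nA A bs z"
      using lspg_constraint_iff_kernel[OF A \<Phi> z, of "N *\<^sub>v c"] block[OF c] zc kernel c by auto
  qed
qed

section \<open>The trial subspace and the reduced solution\<close>

lemma basis_dims:
  assumes "valid_bases D bs" and "i < nsub D"
  shows "int_basis D bs i \<in> carrier_mat (nint D i) (dim_col (int_basis D bs i))"
    and "ifc_basis D bs i \<in> carrier_mat (nifc D i) (dim_col (ifc_basis D bs i))"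
  using assms by (cases bs; auto)+

text \<open>
  A common description for both kinds of bases: for full-subdomain bases the interior coordinates are
  tied to the interface coordinates, otherwise they are free.
\<close>

lemma trial_subspace_iff:
  "w \<in> trial_subspace D bs N \<longleftrightarrow> w \<in> carrier_vec (ndof D) \<and>
    (\<exists>u. \<exists>c \<in> carrier_vec (dim_col N). \<forall>i<nsub D.
      u i \<in> carrier_vec (dim_col (int_basis D bs i)) \<and>
      ((\<exists>\<Phi>. bs = Full_Subdomain \<Phi>) \<longrightarrow> u i = row_block D bs N i *\<^sub>v c) \<and>
      Pint D i *\<^sub>v w = int_basis D bs i *\<^sub>v u i \<and>
      Pifc D i *\<^sub>v w = ifc_basis D bs i *\<^sub>v (row_block D bs N i *\<^sub>v c))"
proof (cases bs)
  case (Interior_Boundary \<Phi>\<Omega> \<Phi>\<Gamma>)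
  then show ?thesis by auto
next
  case (Full_Subdomain \<Phi>)
  let ?R = "row_block D bs N"
  let ?local = "\<lambda>c. \<forall>i<nsub D. Pint D i *\<^sub>v w = int_basis D bs i *\<^sub>v (?R i *\<^sub>v c) \<and>
    Pifc D i *\<^sub>v w = ifc_basis D bs i *\<^sub>v (?R i *\<^sub>v c)"
  have R: "?R i *\<^sub>v c \<in> carrier_vec (dim_col (int_basis D bs i))" for i c
    by (rule carrier_vecI) (simp add: row_block_def Full_Subdomain)
  have "w \<in> trial_subspace D bs N \<longleftrightarrow>
      w \<in> carrier_vec (ndof D) \<and> (\<exists>c \<in> carrier_vec (dim_col N). ?local c)"
    unfolding Full_Subdomain trial_subspace.simps by (rule mem_Collect_eq[THEN trans]) (rule refl)
  also have "(\<exists>c \<in> carrier_vec (dim_col N). ?local c) \<longleftrightarrow>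
      (\<exists>u. \<exists>c \<in> carrier_vec (dim_col N). \<forall>i<nsub D.
        u i \<in> carrier_vec (dim_col (int_basis D bs i)) \<and>
        ((\<exists>\<Phi>. bs = Full_Subdomain \<Phi>) \<longrightarrow> u i = ?R i *\<^sub>v c) \<and>
        Pint D i *\<^sub>v w = int_basis D bs i *\<^sub>v u i \<and>
        Pifc D i *\<^sub>v w = ifc_basis D bs i *\<^sub>v (?R i *\<^sub>v c))" (is "?lhs \<longleftrightarrow> ?rhs")
  proof
    assume ?lhs
    then obtain c where "c \<in> carrier_vec (dim_col N)" "?local c" by blast
    then show ?rhs using R by (intro exI[of _ "\<lambda>i. ?R i *\<^sub>v c"] bexI[of _ c]) simp_all
  next
    assume ?rhs
    then obtain u c where c: "c \<in> carrier_vec (dim_col N)" and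
      u: "\<And>i. i < nsub D \<Longrightarrow> u i = ?R i *\<^sub>v c \<and> Pint D i *\<^sub>v w = int_basis D bs i *\<^sub>v u i \<and>
        Pifc D i *\<^sub>v w = ifc_basis D bs i *\<^sub>v (?R i *\<^sub>v c)"
      using Full_Subdomain by blast
    have "?local c"
    proof (intro allI impI)
      fix i assume "i < nsub D"
      from u[OF this] show "Pint D i *\<^sub>v w = int_basis D bs i *\<^sub>v (?R i *\<^sub>v c) \<and>
          Pifc D i *\<^sub>v w = ifc_basis D bs i *\<^sub>v (?R i *\<^sub>v c)" by metis
    qed
    then show ?lhs using c by blast
  qed
  finally show ?thesis .
qed

lemma mult_mat_vec_lincomb:
  fixes M :: "real mat"
  assumes "M \<in> carrier_mat m n" and "u \<in> carrier_vec n" and "v \<in> carrier_vec n"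
  shows "M *\<^sub>v (u + k \<cdot>\<^sub>v v) = M *\<^sub>v u + k \<cdot>\<^sub>v (M *\<^sub>v v)"
  using assms by (simp add: mult_add_distrib_mat_vec[of M m n] mult_mat_vec[of M m n])

lemma mult_mat_vec_zero:
  fixes M :: "real mat"
  assumes "M \<in> carrier_mat m n"
  shows "M *\<^sub>v 0\<^sub>v n = 0\<^sub>v m"
  using assms by (intro eq_vecI) auto

lemma trial_subspace_linear:
  assumes valid: "valid_system D" and bases: "valid_bases D bs"
  shows "linear_subspace (ndof D) (trial_subspace D bs N)"
proof -
  let ?T = "trial_subspace D bs N"
  let ?\<Omega> = "int_basis D bs" and ?\<Gamma> = "ifc_basis D bs" and ?R = "row_block D bs N"
  have P: "Pint D i \<in> carrier_mat (nint D i) (ndof D)" "Pifc D i \<in> carrier_mat (nifc D i) (ndof D)"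
    if "i < nsub D" for i
    using valid subdomain_sampling[OF _ that]
    by (simp_all add: valid_system_def sampling_matrix_carrier)
  have R: "?R i \<in> carrier_mat (dim_col (?\<Gamma> i)) (dim_col N)" for i
    by (simp add: row_block_def)
  have full: "dim_col (?\<Omega> i) = dim_col (?\<Gamma> i)" if "bs = Full_Subdomain \<Phi>" for i \<Phi>
    using that by simp
  show ?thesis
    unfolding linear_subspace_def
  proof (intro conjI ballI allI)
    show "?T \<subseteq> carrier_vec (ndof D)" by (auto simp: trial_subspace_iff)
    show "0\<^sub>v (ndof D) \<in> ?T"
      unfolding trial_subspace_iff
    proof (intro conjI exI[of _ "\<lambda>i. 0\<^sub>v (dim_col (?\<Omega> i))"] bexI[of _ "0\<^sub>v (dim_col N)"] allI impI)
      fix i assume i: "i < nsub D"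
      note zero = mult_mat_vec_zero[OF P(1)[OF i]] mult_mat_vec_zero[OF P(2)[OF i]]
        mult_mat_vec_zero[OF basis_dims(1)[OF bases i]] mult_mat_vec_zero[OF basis_dims(2)[OF bases i]]
        mult_mat_vec_zero[OF R]
      show "Pint D i *\<^sub>v 0\<^sub>v (ndof D) = ?\<Omega> i *\<^sub>v 0\<^sub>v (dim_col (?\<Omega> i))"
        "Pifc D i *\<^sub>v 0\<^sub>v (ndof D) = ?\<Gamma> i *\<^sub>v (?R i *\<^sub>v 0\<^sub>v (dim_col N))"
        by (simp_all only: zero)
      show "0\<^sub>v (dim_col (?\<Omega> i)) = ?R i *\<^sub>v 0\<^sub>v (dim_col N)" if "\<exists>\<Phi>. bs = Full_Subdomain \<Phi>"
        using that full by (auto simp only: zero)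
    qed simp_all
    let ?coords = "\<lambda>w u c i. u i \<in> carrier_vec (dim_col (?\<Omega> i)) \<and>
      ((\<exists>\<Phi>. bs = Full_Subdomain \<Phi>) \<longrightarrow> u i = ?R i *\<^sub>v c) \<and>
      Pint D i *\<^sub>v w = ?\<Omega> i *\<^sub>v u i \<and> Pifc D i *\<^sub>v w = ?\<Gamma> i *\<^sub>v (?R i *\<^sub>v c)"
    fix w w' k assume "w \<in> ?T" and "w' \<in> ?T"
    from \<open>w \<in> ?T\<close>[unfolded trial_subspace_iff] obtain u c where w: "w \<in> carrier_vec (ndof D)"
      and c: "c \<in> carrier_vec (dim_col N)" and uc: "\<forall>i<nsub D. ?coords w u c i"
      by (elim conjE exE bexE)
    from \<open>w' \<in> ?T\<close>[unfolded trial_subspace_iff] obtain u' c' where w': "w' \<in> carrier_vec (ndof D)"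
      and c': "c' \<in> carrier_vec (dim_col N)" and uc': "\<forall>i<nsub D. ?coords w' u' c' i"
      by (elim conjE exE bexE)
    show "w + k \<cdot>\<^sub>v w' \<in> ?T"
      unfolding trial_subspace_iff
    proof (intro conjI exI[of _ "\<lambda>i. u i + k \<cdot>\<^sub>v u' i"] bexI[of _ "c + k \<cdot>\<^sub>v c'"] allI impI)
      show "w + k \<cdot>\<^sub>v w' \<in> carrier_vec (ndof D)" "c + k \<cdot>\<^sub>v c' \<in> carrier_vec (dim_col N)"
        using w w' c c' by simp_all
      fix i assume i: "i < nsub D"
      have "?coords w u c i" "?coords w' u' c' i" using uc uc' i by blast+
      then have u: "u i \<in> carrier_vec (dim_col (?\<Omega> i))" and u': "u' i \<in> carrier_vec (dim_col (?\<Omega> i))"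
        and fu: "(\<exists>\<Phi>. bs = Full_Subdomain \<Phi>) \<Longrightarrow> u i = ?R i *\<^sub>v c"
        and fu': "(\<exists>\<Phi>. bs = Full_Subdomain \<Phi>) \<Longrightarrow> u' i = ?R i *\<^sub>v c'"
        and eqs: "Pint D i *\<^sub>v w = ?\<Omega> i *\<^sub>v u i" "Pifc D i *\<^sub>v w = ?\<Gamma> i *\<^sub>v (?R i *\<^sub>v c)"
          "Pint D i *\<^sub>v w' = ?\<Omega> i *\<^sub>v u' i" "Pifc D i *\<^sub>v w' = ?\<Gamma> i *\<^sub>v (?R i *\<^sub>v c')"
        by blast+
      have Rc: "?R i *\<^sub>v c \<in> carrier_vec (dim_col (?\<Gamma> i))" "?R i *\<^sub>v c' \<in> carrier_vec (dim_col (?\<Gamma> i))"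
        by (rule mult_mat_vec_carrier[OF R c], rule mult_mat_vec_carrier[OF R c'])
      show "u i + k \<cdot>\<^sub>v u' i \<in> carrier_vec (dim_col (?\<Omega> i))" using u u' by simp
      show "u i + k \<cdot>\<^sub>v u' i = ?R i *\<^sub>v (c + k \<cdot>\<^sub>v c')" if "\<exists>\<Phi>. bs = Full_Subdomain \<Phi>"
        by (simp only: mult_mat_vec_lincomb[OF R c c'] fu[OF that] fu'[OF that])
      show "Pint D i *\<^sub>v (w + k \<cdot>\<^sub>v w') = ?\<Omega> i *\<^sub>v (u i + k \<cdot>\<^sub>v u' i)"
        by (simp only: mult_mat_vec_lincomb[OF P(1)[OF i] w w']
            mult_mat_vec_lincomb[OF basis_dims(1)[OF bases i] u u'] eqs)
      show "Pifc D i *\<^sub>v (w + k \<cdot>\<^sub>v w') = ?\<Gamma> i *\<^sub>v (?R i *\<^sub>v (c + k \<cdot>\<^sub>v c'))"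
        by (simp only: mult_mat_vec_lincomb[OF P(2)[OF i] w w'] mult_mat_vec_lincomb[OF R c c']
            mult_mat_vec_lincomb[OF basis_dims(2)[OF bases i] Rc] eqs)
    qed
  qed
qed

lemma lspg_objective_eq_residual:
  assumes "\<And>i. i < nsub D \<Longrightarrow> Pint D i *\<^sub>v w = y i" and "\<And>i. i < nsub D \<Longrightarrow> Pifc D i *\<^sub>v w = z i"
  shows "lspg_objective D B y z = 1 / 2 * (\<Sum>i<nsub D. (norm2 (B i *\<^sub>v local_residual D i w))\<^sup>2)"
  unfolding lspg_objective_def local_residual_def using assms by simp

text \<open>
  The reduced solution satisfies the constraint, hence it has null-space coordinates and lies in the trial
  subspace. Conversely, the coordinates of any element of the trial subspace are feasible, and the
  objective depends on them only through the local states; so the minimiser over coordinates is also a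
  minimiser over the trial subspace.
\<close>

lemma global_lspg_solution_optimal_on_trial_subspace:
  assumes bases: "valid_bases D bs"
    and A: "\<forall>i<nsub D. A i \<in> carrier_mat nA (nifc D i)"
    and N: "null_basis D nA A bs N"
    and sol: "global_lspg_solution D B nA A bs xt"
  shows "xt \<in> trial_subspace D bs N \<and> (\<forall>w \<in> trial_subspace D bs N.
    (\<Sum>i<nsub D. (norm2 (B i *\<^sub>v local_residual D i xt))\<^sup>2)
      \<le> (\<Sum>i<nsub D. (norm2 (B i *\<^sub>v local_residual D i w))\<^sup>2))"
proof -
  let ?\<Gamma> = "ifc_basis D bs" and ?R = "row_block D bs N"
  have rows: "\<forall>i<nsub D. dim_row (?\<Gamma> i) = nifc D i"
    using basis_dims(2)[OF bases] by (metis carrier_matD(1))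
  note con = lspg_constraint_iff_null_coordinates[OF A rows N]
  have R: "?R i *\<^sub>v c \<in> carrier_vec (dim_col (?\<Gamma> i))" if "c \<in> carrier_vec (dim_col N)" for i c
    by (rule mult_mat_vec_carrier[OF _ that]) (simp add: row_block_def)
  have feasible: "lspg_constraint D nA A bs (\<lambda>i. ?R i *\<^sub>v c)" if "c \<in> carrier_vec (dim_col N)" for c
    using con[of "\<lambda>i. ?R i *\<^sub>v c"] R[OF that] that by blast
  show ?thesis
  proof (cases bs)
    case bs: (Interior_Boundary \<Phi>\<Omega> \<Phi>\<Gamma>)
    obtain xI xG where xt: "xt \<in> carrier_vec (ndof D)"
      and min: "lspg_solution_ib D B nA A \<Phi>\<Omega> \<Phi>\<Gamma> xI xG"
      and loc: "\<And>i. i < nsub D \<Longrightarrow> Pint D i *\<^sub>v xt = \<Phi>\<Omega> i *\<^sub>v xI i"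
        "\<And>i. i < nsub D \<Longrightarrow> Pifc D i *\<^sub>v xt = \<Phi>\<Gamma> i *\<^sub>v xG i"
      using sol unfolding bs by auto
    have xI: "\<And>i. i < nsub D \<Longrightarrow> xI i \<in> carrier_vec (dim_col (\<Phi>\<Omega> i))"
      and xG: "\<And>i. i < nsub D \<Longrightarrow> xG i \<in> carrier_vec (dim_col (\<Phi>\<Gamma> i))"
      and xcon: "lspg_constraint D nA A bs xG"
      using min unfolding lspg_solution_ib_def is_arg_min_def bs by auto
    have opt: "lspg_objective D B (\<lambda>i. \<Phi>\<Omega> i *\<^sub>v xI i) (\<lambda>i. \<Phi>\<Gamma> i *\<^sub>v xG i)
        \<le> lspg_objective D B (\<lambda>i. \<Phi>\<Omega> i *\<^sub>v wI i) (\<lambda>i. \<Phi>\<Gamma> i *\<^sub>v wG i)"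
      if "\<forall>i<nsub D. wI i \<in> carrier_vec (dim_col (\<Phi>\<Omega> i)) \<and> wG i \<in> carrier_vec (dim_col (\<Phi>\<Gamma> i))"
        and "lspg_constraint D nA A bs wG" for wI wG
    proof -
      note min[unfolded lspg_solution_ib_def is_arg_min_def not_ex, THEN conjunct2, THEN spec, of "(wI, wG)"]
      then show ?thesis using that by (simp add: bs not_less)
    qed
    obtain c where "c \<in> carrier_vec (dim_col N)" "\<forall>i<nsub D. xG i = ?R i *\<^sub>v c"
      using con[of xG] xcon xG bs by auto
    then have "xt \<in> trial_subspace D bs N"
      unfolding trial_subspace_iff using xt xI loc bs by auto
    moreover have "(\<Sum>i<nsub D. (norm2 (B i *\<^sub>v local_residual D i xt))\<^sup>2)
        \<le> (\<Sum>i<nsub D. (norm2 (B i *\<^sub>v local_residual D i w))\<^sup>2)"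
      if w: "w \<in> trial_subspace D bs N" for w
    proof -
      obtain wI c where c: "c \<in> carrier_vec (dim_col N)"
        and wI: "\<And>i. i < nsub D \<Longrightarrow> wI i \<in> carrier_vec (dim_col (\<Phi>\<Omega> i))"
        and wloc: "\<And>i. i < nsub D \<Longrightarrow> Pint D i *\<^sub>v w = \<Phi>\<Omega> i *\<^sub>v wI i"
          "\<And>i. i < nsub D \<Longrightarrow> Pifc D i *\<^sub>v w = \<Phi>\<Gamma> i *\<^sub>v (?R i *\<^sub>v c)"
        using w unfolding bs by auto
      have "\<forall>i<nsub D. wI i \<in> carrier_vec (dim_col (\<Phi>\<Omega> i)) \<and> ?R i *\<^sub>v c \<in> carrier_vec (dim_col (\<Phi>\<Gamma> i))"
        using wI R[OF c] bs by simp
      from opt[OF this feasible[OF c]] show ?thesis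
        using lspg_objective_eq_residual[of D xt, OF loc] lspg_objective_eq_residual[of D w, OF wloc]
        by simp
    qed
    ultimately show ?thesis by blast
  next
    case bs: (Full_Subdomain \<Phi>)
    let ?\<Omega> = "int_basis D bs"
    obtain xh where xt: "xt \<in> carrier_vec (ndof D)"
      and min: "lspg_solution_full D B nA A \<Phi> xh"
      and loc: "\<And>i. i < nsub D \<Longrightarrow> Pint D i *\<^sub>v xt = ?\<Omega> i *\<^sub>v xh i"
        "\<And>i. i < nsub D \<Longrightarrow> Pifc D i *\<^sub>v xt = ?\<Gamma> i *\<^sub>v xh i"
      using sol unfolding bs by (auto simp del: int_basis.simps ifc_basis.simps)
    have xh: "\<And>i. i < nsub D \<Longrightarrow> xh i \<in> carrier_vec (dim_col (\<Phi> i))"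
      and xcon: "lspg_constraint D nA A bs xh"
      using min unfolding lspg_solution_full_def is_arg_min_def bs by auto
    have opt: "lspg_objective D B (\<lambda>i. ?\<Omega> i *\<^sub>v xh i) (\<lambda>i. ?\<Gamma> i *\<^sub>v xh i)
        \<le> lspg_objective D B (\<lambda>i. ?\<Omega> i *\<^sub>v y i) (\<lambda>i. ?\<Gamma> i *\<^sub>v y i)"
      if "\<forall>i<nsub D. y i \<in> carrier_vec (dim_col (\<Phi> i))" and "lspg_constraint D nA A bs y" for y
    proof -
      note min[unfolded lspg_solution_full_def is_arg_min_def not_ex, THEN conjunct2, THEN spec, of y]
      then show ?thesis using that by (simp add: bs not_less del: int_basis.simps ifc_basis.simps)
    qed
    obtain c where "c \<in> carrier_vec (dim_col N)" "\<forall>i<nsub D. xh i = ?R i *\<^sub>v c"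
      using con[of xh] xcon xh bs by auto
    then have "xt \<in> trial_subspace D bs N"
      using xt loc unfolding bs by (auto simp del: int_basis.simps ifc_basis.simps)
    moreover have "(\<Sum>i<nsub D. (norm2 (B i *\<^sub>v local_residual D i xt))\<^sup>2)
        \<le> (\<Sum>i<nsub D. (norm2 (B i *\<^sub>v local_residual D i w))\<^sup>2)"
      if w: "w \<in> trial_subspace D bs N" for w
    proof -
      obtain c where c: "c \<in> carrier_vec (dim_col N)"
        and wloc: "\<And>i. i < nsub D \<Longrightarrow> Pint D i *\<^sub>v w = ?\<Omega> i *\<^sub>v (?R i *\<^sub>v c)"
          "\<And>i. i < nsub D \<Longrightarrow> Pifc D i *\<^sub>v w = ?\<Gamma> i *\<^sub>v (?R i *\<^sub>v c)"
        using w unfolding bs by (auto simp del: int_basis.simps ifc_basis.simps)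
      have "\<forall>i<nsub D. ?R i *\<^sub>v c \<in> carrier_vec (dim_col (\<Phi> i))"
        using R[OF c] bs by simp
      from opt[OF this feasible[OF c]] show ?thesis
        using lspg_objective_eq_residual[of D xt, OF loc] lspg_objective_eq_residual[of D w, OF wloc]
        by simp
    qed
    ultimately show ?thesis by blast
  qed
qed

section \<open>Error bound\<close>

theorem proposition3:
  fixes D :: dd_system
    and r :: "real vec \<Rightarrow> real vec"
    and nAbar nA :: nat
    and Abar A B :: "nat \<Rightarrow> real mat"
    and bs :: rom_bases
    and N :: "real mat"
    and S :: "real vec set"
    and \<kappa>l \<kappa>u P :: real
    and x xt :: "real vec"
  assumes system: "valid_system D"
    and residual: "\<forall>w \<in> carrier_vec (ndof D). r w = assembled_residual D w"
    and strong: "strong_constraints D nAbar Abar"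
    and bases: "valid_bases D bs"
    and B: "\<forall>i<nsub D. dim_row (B i) \<le> nres D i \<and> dim_col (B i) = nres D i"
    and A: "\<forall>i<nsub D. A i \<in> carrier_mat nA (nifc D i)"
    and N: "null_basis D nAbar Abar bs N"
    and S: "S = trial_subspace D bs N"
    and A1: "\<forall>i<nsub D. A i = Abar i"
    and A2: "\<kappa>l > 0"
      "\<forall>w \<in> carrier_vec (ndof D). \<forall>y \<in> carrier_vec (ndof D).
         sqrt (\<Sum>i<nsub D. (norm2 (local_residual D i w - local_residual D i y))\<^sup>2)
           \<ge> \<kappa>l * norm2 (w - y)"
    and A3: "P > 0"
      "\<forall>w \<in> S.
         sqrt (\<Sum>i<nsub D. (norm2 (B i *\<^sub>v local_residual D i w))\<^sup>2)
           \<ge> P * sqrt (\<Sum>i<nsub D. (norm2 (local_residual D i w))\<^sup>2)"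
    and A4: "\<kappa>u > 0"
      "\<forall>w \<in> carrier_vec (ndof D). \<forall>y \<in> carrier_vec (ndof D).
         sqrt (\<Sum>i<nsub D. (norm2 (B i *\<^sub>v local_residual D i w - B i *\<^sub>v local_residual D i y))\<^sup>2)
           \<le> \<kappa>u * norm2 (w - y)"
    and x: "x \<in> carrier_vec (ndof D)" "r x = 0\<^sub>v (ndof D)"
    and xt: "global_lspg_solution D B nA A bs xt"
  shows "\<exists>w. is_arg_min (segment_dist D x) (\<lambda>w. w \<in> S) w \<and>
           segment_dist D x xt
             \<le> \<kappa>u * sqrt (real (nsub D + nport D)) / (P * \<kappa>l) * segment_dist D x w"
proof -
  let ?n = "ndof D"
  have vsub: "valid_subdomains D" using system by (simp add: valid_system_def)
  \<comment> \<open>There is at least one subdomain, and its constraint matrix determines the row count.\<close>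
  have "nA = nAbar"
    using A A1 strong vsub unfolding strong_constraints_def valid_subdomains_def by (metis carrier_matD(1))
  moreover have "coupling_matrix D nAbar A bs = coupling_matrix D nAbar Abar bs"
    using A1 by (rule coupling_matrix_cong)
  ultimately have nullA: "null_basis D nA A bs N" using N by (simp add: null_basis_def)
  have xtS: "xt \<in> S" and opt: "\<And>w. w \<in> S \<Longrightarrow>
      (\<Sum>i<nsub D. (norm2 (B i *\<^sub>v local_residual D i xt))\<^sup>2)
        \<le> (\<Sum>i<nsub D. (norm2 (B i *\<^sub>v local_residual D i w))\<^sup>2)"
    using global_lspg_solution_optimal_on_trial_subspace[OF bases A nullA xt] unfolding S by auto
  have lin: "linear_subspace ?n S" unfolding S by (rule trial_subspace_linear[OF system bases])
  then have Scar: "w \<in> carrier_vec ?n" if "w \<in> S" for w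
    using that by (auto simp: linear_subspace_def)
  note dist = segment_dist_eq_segment_norm[OF system x(1) Scar]
  obtain w where w: "w \<in> S"
    and near: "\<And>y. y \<in> S \<Longrightarrow> segment_norm D (x - w) \<le> segment_norm D (x - y)"
    using linear_subspace_proximinal[OF lin] segment_norm_seminorm[OF system] x(1)
    unfolding proximinal_def by blast
  have min: "is_arg_min (segment_dist D x) (\<lambda>w. w \<in> S) w"
    using w near dist by (fastforce simp: is_arg_min_def not_less)
  \<comment> \<open>The local residuals vanish at the full-order solution, so that \<open>A2\<close> and \<open>A4\<close> with \<open>x\<close> as one of
    the two states bound the residuals themselves.\<close>
  have rx: "local_residual D i x = 0\<^sub>v (nres D i)" if "i < nsub D" for i
    using assembled_residual_zero_imp_local[OF vsub x(1) _ that] residual x by simp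
  have dims: "dim_vec (local_residual D i y) = nres D i" if "i < nsub D" "y \<in> carrier_vec ?n" for i y
    using local_residual_carrier[OF vsub that(2,1)] by simp
  have Bx: "B i *\<^sub>v local_residual D i x = 0\<^sub>v (dim_row (B i))" if "i < nsub D" for i
  proof -
    have "B i \<in> carrier_mat (dim_row (B i)) (nres D i)"
      using B that by (intro carrier_matI) blast+
    then show ?thesis unfolding rx[OF that] by (rule mult_mat_vec_zero)
  qed
  have "\<kappa>l * norm2 (x - xt)
      \<le> sqrt (\<Sum>i<nsub D. (norm2 (local_residual D i x - local_residual D i xt))\<^sup>2)"
    using A2(2) x(1) Scar[OF xtS] by blast
  also have "\<dots> = sqrt (\<Sum>i<nsub D. (norm2 (local_residual D i xt))\<^sup>2)"
    using rx dims[OF _ Scar[OF xtS]] by (simp add: norm2_zero_minus)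
  finally have "P * (\<kappa>l * norm2 (x - xt)) \<le> P * sqrt (\<Sum>i<nsub D. (norm2 (local_residual D i xt))\<^sup>2)"
    using A3(1) by simp
  also have "\<dots> \<le> sqrt (\<Sum>i<nsub D. (norm2 (B i *\<^sub>v local_residual D i xt))\<^sup>2)"
    using A3(2) xtS by blast
  also have "\<dots> \<le> sqrt (\<Sum>i<nsub D. (norm2 (B i *\<^sub>v local_residual D i w))\<^sup>2)"
    using opt[OF w] by simp
  also have "\<dots> = sqrt (\<Sum>i<nsub D.
      (norm2 (B i *\<^sub>v local_residual D i x - B i *\<^sub>v local_residual D i w))\<^sup>2)"
    using Bx by (simp add: norm2_zero_minus)
  also have "\<dots> \<le> \<kappa>u * norm2 (x - w)"
    using A4(2) x(1) Scar[OF w] by blast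
  also have "\<dots> \<le> \<kappa>u * (sqrt (real (nsub D + nport D)) * segment_dist D x w)"
    using norm2_le_segment_norm[OF system, of "x - w"] x(1) Scar[OF w] A4(1) dist[OF w]
    by (intro mult_left_mono) auto
  finally have bound: "P * (\<kappa>l * norm2 (x - xt))
      \<le> \<kappa>u * (sqrt (real (nsub D + nport D)) * segment_dist D x w)" .
  have "segment_dist D x xt \<le> norm2 (x - xt)"
    using segment_norm_le_norm2[OF system, of "x - xt"] x(1) Scar[OF xtS] dist[OF xtS] by simp
  also have "\<dots> \<le> \<kappa>u * sqrt (real (nsub D + nport D)) / (P * \<kappa>l) * segment_dist D x w"
    using bound A2(1) A3(1) by (simp add: field_simps)
  finally show ?thesis using min by blast
qed

end
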